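(* Let $G$ be a compact group, $K$ a closed subgroup, and let $\phi$ be a continuous, positive definite, bi-$K$-invariant function on $G$. Then there exists a bi-$K$-invariant function $f\in L^2(G)$ such that $\phi=f*\breve f$. Moreover, if $\phi$ is real valued, then $f$ can also be chosen real valued.
   Context: $G$ is a compact (Hausdorff, second countable) topological group with Haar probability measure $dg$ and $K\subset G$ is a closed subgroup. A function $\phi:G\to\mathbb C$ is positive definite if $\sum_{i,j=1}^m\phi(g_i^{-1}g_j)\overline{\xi_i}\xi_j\ge0$ for all $m$, $g_i\in G$, $\xi_i\in\mathbb C$. A function $f$ on $G$ is bi-$K$-invariant if $f(k_1gk_2)=f(g)$ for all $g\in G$, $k_1,k_2\in K$. For functions on $G$, $\breve f(g)=\overline{f(g^{-1})}$ and $(f_1*f_2)(g)=\int_G f_1(h)f_2(h^{-1}g)\,dh$. *)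

theory Defs
  imports "HOL-Probability.Probability"
begin

definition compact_group ::
  "('g::{t2_space,second_countable_topology} \<Rightarrow> 'g \<Rightarrow> 'g) \<Rightarrow> ('g \<Rightarrow> 'g) \<Rightarrow> 'g \<Rightarrow> bool" where
  "compact_group gmul ginv e \<longleftrightarrow>
     (\<forall>x y z. gmul (gmul x y) z = gmul x (gmul y z)) \<and>
     (\<forall>x. gmul e x = x \<and> gmul x e = x) \<and>
     (\<forall>x. gmul (ginv x) x = e \<and> gmul x (ginv x) = e) \<and>
     continuous_on UNIV (\<lambda>p::'g \<times> 'g. gmul (fst p) (snd p)) \<and>
     continuous_on UNIV ginv \<and>
     compact (UNIV :: 'g set)"

definition haar_prob ::
  "('g::topological_space \<Rightarrow> 'g \<Rightarrow> 'g) \<Rightarrow> 'g measure \<Rightarrow> bool" where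
  "haar_prob gmul \<mu> \<longleftrightarrow>
     sets \<mu> = sets borel \<and> prob_space \<mu> \<and>
     (\<forall>g. \<forall>A \<in> sets borel. emeasure \<mu> ((gmul g) ` A) = emeasure \<mu> A)"

definition closed_subgroup ::
  "('g::topological_space \<Rightarrow> 'g \<Rightarrow> 'g) \<Rightarrow> ('g \<Rightarrow> 'g) \<Rightarrow> 'g \<Rightarrow> 'g set \<Rightarrow> bool" where
  "closed_subgroup gmul ginv e K \<longleftrightarrow>
     closed K \<and> e \<in> K \<and> (\<forall>x\<in>K. \<forall>y\<in>K. gmul x y \<in> K) \<and> (\<forall>x\<in>K. ginv x \<in> K)"

definition positive_definite ::
  "('g \<Rightarrow> 'g \<Rightarrow> 'g) \<Rightarrow> ('g \<Rightarrow> 'g) \<Rightarrow> ('g \<Rightarrow> complex) \<Rightarrow> bool" where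
  "positive_definite gmul ginv \<phi> \<longleftrightarrow>
     (\<forall>(m::nat) (g::nat \<Rightarrow> 'g) (\<xi>::nat \<Rightarrow> complex).
        let s = (\<Sum>i<m. \<Sum>j<m. \<phi> (gmul (ginv (g i)) (g j)) * cnj (\<xi> i) * \<xi> j)
        in Im s = 0 \<and> Re s \<ge> 0)"

definition bi_invariant ::
  "('g \<Rightarrow> 'g \<Rightarrow> 'g) \<Rightarrow> 'g set \<Rightarrow> ('g \<Rightarrow> 'a) \<Rightarrow> bool" where
  "bi_invariant gmul K f \<longleftrightarrow>
     (\<forall>g. \<forall>k1\<in>K. \<forall>k2\<in>K. f (gmul (gmul k1 g) k2) = f g)"

definition breve :: "('g \<Rightarrow> 'g) \<Rightarrow> ('g \<Rightarrow> complex) \<Rightarrow> 'g \<Rightarrow> complex" where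
  "breve ginv f = (\<lambda>g. cnj (f (ginv g)))"

definition conv ::
  "'g measure \<Rightarrow> ('g \<Rightarrow> 'g \<Rightarrow> 'g) \<Rightarrow> ('g \<Rightarrow> 'g) \<Rightarrow> ('g \<Rightarrow> complex) \<Rightarrow> ('g \<Rightarrow> complex) \<Rightarrow> 'g \<Rightarrow> complex" where
  "conv \<mu> gmul ginv f1 f2 = (\<lambda>g. \<integral>h. f1 h * f2 (gmul (ginv h) g) \<partial>\<mu>)"

text \<open>Square-integrable (a representative of an element of L^2(G)).\<close>
definition L2 :: "'g measure \<Rightarrow> ('g \<Rightarrow> complex) \<Rightarrow> bool" where
  "L2 \<mu> f \<longleftrightarrow> f \<in> borel_measurable \<mu> \<and> integrable \<mu> (\<lambda>x. (cmod (f x))\<^sup>2)"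

end

theory Submission
  imports Defs
begin

text \<open>
  Write \<open>t\<close> for \<open>\<phi>\<close> in the convolution algebra, scaled so that \<open>\<phi>(e) \<le> 1\<close>. The function \<open>f\<close> is
  the convolution square root of \<open>t\<close>, obtained without spectral theory from the binomial series
  \<open>\<surd>t = \<Sum>\<^sub>j c\<^sub>j t (1 - t)\<^sup>j\<close>, where the \<open>c\<^sub>j \<ge> 0\<close> are the coefficients of
  \<open>(1 - x)\<close> to the power \<open>-1/2\<close> and hence satisfy \<open>\<Sum>\<^sub>i\<^sub>+\<^sub>j\<^sub>=\<^sub>m c\<^sub>i c\<^sub>j = 1\<close>.
  With \<open>a\<^sub>m\<close> the value of \<open>t\<^sup>2 (1 - t)\<^sup>m\<close> at the unit, positive definiteness gives
  \<open>a\<^sub>m \<ge> 0\<close> and \<open>\<Sum> a\<^sub>m \<le> \<phi>(e)\<close>. The \<open>L\<^sup>2\<close> inner product of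
  \<open>t (1 - t)\<^sup>i\<close> and \<open>t (1 - t)\<^sup>j\<close> is \<open>a\<^sub>i\<^sub>+\<^sub>j\<close>, so the series converges in
  \<open>L\<^sup>2\<close>; its square is \<open>\<Sum> t\<^sup>2 (1 - t)\<^sup>m = t - lim t (1 - t)\<^sup>n\<close>, and the last limit vanishes
  because it is uniform while the squared \<open>L\<^sup>2\<close> norm of \<open>t (1 - t)\<^sup>n\<close> is \<open>a\<^sub>2\<^sub>n\<close>.
  Every term of the series inherits bi-invariance and reality from \<open>\<phi>\<close>, and \<open>f\<close> is a pointwise limit of
  partial sums where these converge and zero elsewhere, so it inherits them at every point.
\<close>

section \<open>The binomial series of the inverse square root\<close>

definition inv_sqrt_coeff :: "nat \<Rightarrow> real"
  where "inv_sqrt_coeff j = pochhammer (1/2) j / fact j"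

lemma inv_sqrt_coeff_nonneg: "0 \<le> inv_sqrt_coeff j"
  by (simp add: inv_sqrt_coeff_def pochhammer_nonneg)

text \<open>Vandermonde's identity for rising factorials with both parameters \<open>1/2\<close>:
  the parameters add up to 1, and the rising factorial of 1 is \<open>fact m\<close>.\<close>

lemma inv_sqrt_coeff_square: "(\<Sum>i\<le>m. inv_sqrt_coeff i * inv_sqrt_coeff (m - i)) = 1"
proof -
  have "fact m * (\<Sum>i\<le>m. inv_sqrt_coeff i * inv_sqrt_coeff (m - i)) =
      (\<Sum>i\<le>m. of_nat (m choose i) * pochhammer (1/2) i * pochhammer (1/2) (m - i))"
    unfolding sum_distrib_left
    by (rule sum.cong) (simp_all add: inv_sqrt_coeff_def binomial_fact)
  also have "\<dots> = fact m"
    using pochhammer_binomial_sum[of "1/2 :: real" "1/2" m] by (simp add: pochhammer_fact)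
  finally show ?thesis by simp
qed

text \<open>A full antidiagonal \<open>i + j = m\<close> carries total weight 1 by
  \<open>inv_sqrt_coeff_square\<close>; as all terms are nonnegative, an antidiagonal that
  \<open>P\<close> meets only partly carries at most that. The estimate serves both the remainder of
  a Cauchy product and the \<open>L2\<close> norms of partial sums of the root.\<close>

lemma inv_sqrt_coeff_pairs_le:
  assumes "finite P" "finite S" "\<And>i j. (i, j) \<in> P \<Longrightarrow> i + j \<in> S" "\<And>m. 0 \<le> b m"
  shows "(\<Sum>(i, j)\<in>P. inv_sqrt_coeff i * inv_sqrt_coeff j * b (i + j)) \<le> (\<Sum>m\<in>S. b m)"
proof -
  let ?c = inv_sqrt_coeff
  have "(\<Sum>(i, j)\<in>P. ?c i * ?c j * b (i + j)) =
      (\<Sum>m\<in>S. \<Sum>(i, j)\<in>{p \<in> P. fst p + snd p = m}. ?c i * ?c j * b (i + j))"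
    using assms(1-3) by (intro sum.group[symmetric]) auto
  also have "\<dots> \<le> (\<Sum>m\<in>S. b m)"
  proof (rule sum_mono)
    fix m
    have "(\<Sum>(i, j)\<in>{p \<in> P. fst p + snd p = m}. ?c i * ?c j * b (i + j)) \<le>
        (\<Sum>(i, j)\<in>(\<lambda>i. (i, m - i)) ` {..m}. ?c i * ?c j * b (i + j))"
      using assms(4) by (intro sum_mono2) (auto simp: inv_sqrt_coeff_nonneg image_iff)
    also have "\<dots> = (\<Sum>i\<le>m. ?c i * ?c (m - i)) * b m"
      by (subst sum.reindex) (auto simp: inj_on_def sum_distrib_right)
    finally show "(\<Sum>(i, j)\<in>{p \<in> P. fst p + snd p = m}. ?c i * ?c j * b (i + j)) \<le> b m"
      by (simp add: inv_sqrt_coeff_square)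
  qed
  finally show ?thesis .
qed

text \<open>The triangle \<open>i + j < n\<close> inside the square contributes exactly the
  \<open>n\<close>-th partial sum of \<open>v\<close>. The remaining corner has
  \<open>n \<le> i + j < 2 * n\<close>, so it is dominated by a block of the convergent series of
  norms.\<close>

lemma inv_sqrt_coeff_Cauchy_product:
  fixes v :: "nat \<Rightarrow> complex"
  assumes "summable (\<lambda>m. cmod (v m))"
  shows "(\<lambda>n. \<Sum>i<n. \<Sum>j<n. of_real (inv_sqrt_coeff i * inv_sqrt_coeff j) * v (i + j)) \<longlonglongrightarrow> (\<Sum>m. v m)"
proof -
  let ?c = inv_sqrt_coeff
  define D where "D n = (\<Sum>i<n. \<Sum>j<n. of_real (?c i * ?c j) * v (i + j))" for n
  have bound: "cmod (D n - (\<Sum>m<n. v m)) \<le> (\<Sum>m<2 * n. cmod (v m)) - (\<Sum>m<n. cmod (v m))" for n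
  proof -
    define P where "P = ({..<n} \<times> {..<n}) \<inter> {(i, j). i + j \<ge> n}"
    define T where "T = ({..<n} \<times> {..<n}) \<inter> - {(i, j). i + j \<ge> n}"
    have sumT: "(\<Sum>(i, j)\<in>T. of_real (?c i * ?c j) * v (i + j)) = (\<Sum>m<n. v m)"
    proof -
      have "(\<Sum>(i, j)\<in>T. of_real (?c i * ?c j) * v (i + j)) =
          (\<Sum>(m, i)\<in>(SIGMA m:{..<n}. {..m}). of_real (?c i * ?c (m - i)) * v m)"
        by (rule sum.reindex_bij_witness[where i="\<lambda>(m, i). (i, m - i)" and j="\<lambda>(i, j). (i + j, i)"])
          (auto simp: T_def)
      also have "\<dots> = (\<Sum>m<n. of_real (\<Sum>i\<le>m. ?c i * ?c (m - i)) * v m)"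
        by (subst sum.Sigma[symmetric]) (auto simp: sum_distrib_right)
      finally show ?thesis by (simp add: inv_sqrt_coeff_square)
    qed
    have "D n = (\<Sum>(i, j)\<in>{..<n} \<times> {..<n}. of_real (?c i * ?c j) * v (i + j))"
      by (simp add: D_def sum.cartesian_product)
    also have "\<dots> = (\<Sum>(i, j)\<in>P. of_real (?c i * ?c j) * v (i + j)) + (\<Sum>m<n. v m)"
      unfolding P_def sumT[symmetric] T_def by (rule sum.Int_Diff[unfolded Diff_eq]) simp
    finally have "cmod (D n - (\<Sum>m<n. v m)) = cmod (\<Sum>(i, j)\<in>P. of_real (?c i * ?c j) * v (i + j))"
      by simp
    also have "\<dots> \<le> (\<Sum>(i, j)\<in>P. ?c i * ?c j * cmod (v (i + j)))"
      by (rule order.trans[OF norm_sum]) (auto simp: norm_mult inv_sqrt_coeff_nonneg intro!: sum_mono)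
    also have "\<dots> \<le> (\<Sum>m\<in>{n..<2 * n}. cmod (v m))"
      by (rule inv_sqrt_coeff_pairs_le) (auto simp: P_def)
    also have "\<dots> = (\<Sum>m<2 * n. cmod (v m)) - (\<Sum>m<n. cmod (v m))"
      using sum_diff_nat_ivl[of 0 n "2 * n" "\<lambda>m. cmod (v m)"] by (simp add: atLeast0LessThan)
    finally show ?thesis .
  qed
  have lim: "(\<lambda>n. \<Sum>m<n. cmod (v m)) \<longlonglongrightarrow> (\<Sum>m. cmod (v m))"
    using assms by (rule summable_LIMSEQ)
  have "(\<lambda>n. \<Sum>m<2 * n. cmod (v m)) \<longlonglongrightarrow> (\<Sum>m. cmod (v m))"
    using LIMSEQ_subseq_LIMSEQ[OF lim, of "\<lambda>n. 2 * n"] by (simp add: strict_mono_def o_def)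
  from tendsto_diff[OF this lim]
  have "(\<lambda>n. D n - (\<Sum>m<n. v m)) \<longlonglongrightarrow> 0"
    by (intro Lim_null_comparison[OF always_eventually[OF allI[OF bound]]]) simp
  from tendsto_add[OF this summable_LIMSEQ[OF summable_norm_cancel[OF assms]]]
  show ?thesis by (simp add: D_def)
qed

section \<open>Square-integrable functions\<close>

lemma L2_product:
  fixes a b :: "'x \<Rightarrow> complex"
  assumes a: "L2 M a" and b: "L2 M b"
  shows "integrable M (\<lambda>x. a x * b x)"
    and "cmod (\<integral>x. a x * b x \<partial>M) \<le> sqrt ((\<integral>x. (cmod (a x))\<^sup>2 \<partial>M) * (\<integral>x. (cmod (b x))\<^sup>2 \<partial>M))"
proof -
  define A where "A = (\<integral>x. (cmod (a x))\<^sup>2 \<partial>M)"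
  define B where "B = (\<integral>x. (cmod (b x))\<^sup>2 \<partial>M)"
  have [measurable]: "a \<in> borel_measurable M" "b \<in> borel_measurable M"
    and [simp]: "integrable M (\<lambda>x. (cmod (a x))\<^sup>2)" "integrable M (\<lambda>x. (cmod (b x))\<^sup>2)"
    using a b by (auto simp: L2_def)
  \<comment> \<open>Young's inequality with a free parameter: the value 1 gives integrability of the
    product, and a nearly optimal value gives Cauchy-Schwarz.\<close>
  have young: "s * t \<le> (s\<^sup>2 / \<epsilon> + \<epsilon> * t\<^sup>2) / 2" if "\<epsilon> > 0" for s t \<epsilon> :: real
  proof -
    have "0 \<le> (s - \<epsilon> * t)\<^sup>2 / \<epsilon>" using that by simp
    also have "\<dots> = s\<^sup>2 / \<epsilon> + \<epsilon> * t\<^sup>2 - 2 * (s * t)"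
      using that by (simp add: field_simps power2_eq_square)
    finally show ?thesis by simp
  qed
  show int: "integrable M (\<lambda>x. a x * b x)"
  proof (rule Bochner_Integration.integrable_bound)
    show "integrable M (\<lambda>x. ((cmod (a x))\<^sup>2 / 1 + 1 * (cmod (b x))\<^sup>2) / 2)" by simp
    show "AE x in M. norm (a x * b x) \<le> norm (((cmod (a x))\<^sup>2 / 1 + 1 * (cmod (b x))\<^sup>2) / 2)"
      using young[of 1] by (intro always_eventually allI) (simp add: norm_mult)
  qed measurable
  have bound: "cmod (\<integral>x. a x * b x \<partial>M) \<le> (A / \<epsilon> + \<epsilon> * B) / 2" if "\<epsilon> > 0" for \<epsilon>
  proof -
    have "cmod (\<integral>x. a x * b x \<partial>M) \<le> (\<integral>x. cmod (a x * b x) \<partial>M)"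
      by (rule integral_norm_bound)
    also have "\<dots> \<le> (\<integral>x. ((cmod (a x))\<^sup>2 / \<epsilon> + \<epsilon> * (cmod (b x))\<^sup>2) / 2 \<partial>M)"
      using young[OF that] by (intro integral_mono integrable_norm int) (auto simp: norm_mult)
    also have "\<dots> = (A / \<epsilon> + \<epsilon> * B) / 2"
      by (simp add: A_def B_def)
    finally show ?thesis .
  qed
  have AB: "A \<ge> 0" "B \<ge> 0" by (simp_all add: A_def B_def)
  \<comment> \<open>The optimal parameter would be \<open>sqrt (A / B)\<close>; adding \<delta> to
    both numbers keeps it positive and finite when one of them vanishes, and \<delta> is then sent
    to 0 from the right.\<close>
  have "cmod (\<integral>x. a x * b x \<partial>M) \<le> sqrt ((A + \<delta>) * (B + \<delta>))" if "\<delta> > 0" for \<delta>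
  proof -
    define s where "s = sqrt (A + \<delta>)"
    define t where "t = sqrt (B + \<delta>)"
    have st: "s > 0" "t > 0" "A \<le> s * s" "B \<le> t * t"
      using AB that by (simp_all add: s_def t_def)
    have "A / (s / t) \<le> s * t" "s / t * B \<le> s * t"
      using st by (simp_all add: field_simps mult_left_mono)
    then have "cmod (\<integral>x. a x * b x \<partial>M) \<le> s * t"
      using bound[of "s / t"] st by simp
    then show ?thesis by (simp add: s_def t_def real_sqrt_mult)
  qed
  then have "\<forall>\<^sub>F \<delta> in at_right 0. cmod (\<integral>x. a x * b x \<partial>M) \<le> sqrt ((A + \<delta>) * (B + \<delta>))"
    by (simp add: eventually_at_filter)
  moreover have "((\<lambda>\<delta>. sqrt ((A + \<delta>) * (B + \<delta>))) \<longlongrightarrow> sqrt ((A + 0) * (B + 0))) (at_right 0)"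
    by (intro tendsto_intros)
  ultimately have "cmod (\<integral>x. a x * b x \<partial>M) \<le> sqrt ((A + 0) * (B + 0))"
    by (intro tendsto_lowerbound) auto
  then show "cmod (\<integral>x. a x * b x \<partial>M) \<le>
      sqrt ((\<integral>x. (cmod (a x))\<^sup>2 \<partial>M) * (\<integral>x. (cmod (b x))\<^sup>2 \<partial>M))"
    by (simp add: A_def B_def)
qed

lemma L2_add:
  assumes "L2 M a" "L2 M b"
  shows "L2 M (\<lambda>x. a x + b x)"
proof -
  have [measurable]: "a \<in> borel_measurable M" "b \<in> borel_measurable M"
    and sq: "integrable M (\<lambda>x. (cmod (a x))\<^sup>2)" "integrable M (\<lambda>x. (cmod (b x))\<^sup>2)"
    using assms by (auto simp: L2_def)
  have sq_sum: "(cmod (s + t))\<^sup>2 \<le> 2 * (cmod s)\<^sup>2 + 2 * (cmod t)\<^sup>2" for s t :: complex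
  proof -
    have "(cmod (s + t))\<^sup>2 \<le> (cmod s + cmod t)\<^sup>2" by (intro power_mono norm_triangle_ineq) simp
    moreover have "0 \<le> (cmod s - cmod t)\<^sup>2" by simp
    ultimately show ?thesis unfolding power2_sum power2_diff by linarith
  qed
  have "integrable M (\<lambda>x. (cmod (a x + b x))\<^sup>2)"
  proof (rule Bochner_Integration.integrable_bound)
    show "integrable M (\<lambda>x. 2 * (cmod (a x))\<^sup>2 + 2 * (cmod (b x))\<^sup>2)" using sq by simp
    show "AE x in M. norm ((cmod (a x + b x))\<^sup>2) \<le> norm (2 * (cmod (a x))\<^sup>2 + 2 * (cmod (b x))\<^sup>2)"
      using sq_sum by (intro always_eventually allI) simp
  qed measurable
  then show ?thesis by (simp add: L2_def)
qed

lemma L2_diff: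
  assumes "L2 M a" "L2 M b"
  shows "L2 M (\<lambda>x. a x - b x)"
  using L2_add[of M a "\<lambda>x. - b x"] assms by (simp add: L2_def)

text \<open>Completeness of \<open>L2\<close> with an explicit representative. Obtaining only the
  subsequence \<open>r\<close>, with the limit spelled out in the values \<open>F (r i) x\<close>,
  lets properties of all \<open>F n\<close> that survive limits and hold for 0 pass on at every
  point, not merely almost everywhere.\<close>

lemma (in prob_space) L2_Cauchy_pointwise_limit:
  fixes F :: "nat \<Rightarrow> 'a \<Rightarrow> complex"
  assumes L2: "\<And>n. L2 M (F n)"
    and Cauchy: "\<And>\<epsilon>. \<epsilon> > 0 \<Longrightarrow> \<exists>N. \<forall>i\<ge>N. \<forall>j\<ge>N. (\<integral>x. (cmod (F i x - F j x))\<^sup>2 \<partial>M) < \<epsilon>"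
  obtains r where
    "L2 M (\<lambda>x. if Cauchy (\<lambda>i. F (r i) x) then lim (\<lambda>i. F (r i) x) else 0)"
    "(\<lambda>n. \<integral>x. (cmod ((if Cauchy (\<lambda>i. F (r i) x) then lim (\<lambda>i. F (r i) x) else 0) - F n x))\<^sup>2 \<partial>M) \<longlonglongrightarrow> 0"
proof -
  have meas [measurable]: "F n \<in> borel_measurable M" for n using L2 by (simp add: L2_def)
  have sq: "integrable M (\<lambda>x. (cmod (F n x))\<^sup>2)" for n using L2 by (simp add: L2_def)
  have sq_diff: "integrable M (\<lambda>x. (cmod (F i x - F j x))\<^sup>2)" for i j
    using L2_diff[OF L2 L2, of i j] by (simp add: L2_def)
  have amgm: "t \<le> (t\<^sup>2 / \<epsilon> + \<epsilon>) / 2" if "\<epsilon> > 0" for t \<epsilon> :: real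
  proof -
    have "0 \<le> (t - \<epsilon>)\<^sup>2 / \<epsilon>" using that by simp
    also have "\<dots> = t\<^sup>2 / \<epsilon> + \<epsilon> - 2 * t" using that by (simp add: field_simps power2_eq_square)
    finally show ?thesis by simp
  qed
  have int: "integrable M (F n)" for n
  proof (rule Bochner_Integration.integrable_bound)
    show "integrable M (\<lambda>x. ((cmod (F n x))\<^sup>2 / 1 + 1) / 2)" using sq by simp
    show "AE x in M. norm (F n x) \<le> norm (((cmod (F n x))\<^sup>2 / 1 + 1) / 2)"
      using amgm[of 1] by (intro always_eventually allI) simp
  qed measurable
  \<comment> \<open>On a probability space, Cauchy in mean square implies Cauchy in mean; a squared
    distance below \<open>\<epsilon>\<^sup>2\<close> brings the bound from \<open>amgm\<close> below
    \<epsilon>.\<close>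
  have "\<exists>N. \<forall>i\<ge>N. \<forall>j\<ge>N. (\<integral>x. norm (F i x - F j x) \<partial>M) < \<epsilon>" if eps: "\<epsilon> > 0" for \<epsilon>
  proof -
    obtain N where N: "\<forall>i\<ge>N. \<forall>j\<ge>N. (\<integral>x. (cmod (F i x - F j x))\<^sup>2 \<partial>M) < \<epsilon>\<^sup>2"
      using Cauchy[of "\<epsilon>\<^sup>2"] eps by auto
    have "(\<integral>x. norm (F i x - F j x) \<partial>M) < \<epsilon>" if "i \<ge> N" "j \<ge> N" for i j
    proof -
      have "(\<integral>x. norm (F i x - F j x) \<partial>M) \<le> (\<integral>x. ((cmod (F i x - F j x))\<^sup>2 / \<epsilon> + \<epsilon>) / 2 \<partial>M)"
        using sq_diff amgm[OF \<open>\<epsilon> > 0\<close>] int by (intro integral_mono) auto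
      also have "\<dots> = ((\<integral>x. (cmod (F i x - F j x))\<^sup>2 \<partial>M) / \<epsilon> + \<epsilon>) / 2"
        using sq_diff by (simp add: prob_space)
      also have "\<dots> < (\<epsilon>\<^sup>2 / \<epsilon> + \<epsilon>) / 2"
        using N[rule_format, OF that] \<open>\<epsilon> > 0\<close> by (simp add: divide_strict_right_mono)
      also have "\<dots> = \<epsilon>" using \<open>\<epsilon> > 0\<close> by (simp add: power2_eq_square)
      finally show ?thesis .
    qed
    then show ?thesis by blast
  qed
  then obtain r where r: "strict_mono r" "AE x in M. Cauchy (\<lambda>i. F (r i) x)"
    using cauchy_L1_AE_cauchy_subseq[of M F] int by blast
  define f where "f x = (if Cauchy (\<lambda>i. F (r i) x) then lim (\<lambda>i. F (r i) x) else 0)" for x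
  have f_meas [measurable]: "f \<in> borel_measurable M"
    unfolding f_def by measurable
  have lim: "AE x in M. (\<lambda>i. F (r i) x) \<longlonglongrightarrow> f x"
    using r(2) by eventually_elim (simp add: f_def Cauchy_convergent_iff convergent_LIMSEQ_iff)
  have tail: "\<exists>N. \<forall>n\<ge>N. integrable M (\<lambda>x. (cmod (f x - F n x))\<^sup>2) \<and>
      (\<integral>x. (cmod (f x - F n x))\<^sup>2 \<partial>M) \<le> \<epsilon>" if eps: "\<epsilon> > 0" for \<epsilon>
  proof -
    obtain N where N: "\<forall>i\<ge>N. \<forall>j\<ge>N. (\<integral>x. (cmod (F i x - F j x))\<^sup>2 \<partial>M) < \<epsilon>"
      using Cauchy[OF eps] by auto
    \<comment> \<open>Fatou's lemma along the subsequence, with \<open>n\<close> fixed, covers every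
      \<open>n \<ge> N\<close>. Nonnegative integrals are used because the integrability of the
      difference is still unknown and will follow from this bound.\<close>
    have nn: "(\<integral>\<^sup>+x. ennreal ((cmod (f x - F n x))\<^sup>2) \<partial>M) \<le> ennreal \<epsilon>" if "n \<ge> N" for n
    proof -
      have "(\<integral>\<^sup>+x. ennreal ((cmod (f x - F n x))\<^sup>2) \<partial>M) =
          (\<integral>\<^sup>+x. liminf (\<lambda>i. ennreal ((cmod (F (r i) x - F n x))\<^sup>2)) \<partial>M)"
      proof (rule nn_integral_cong_AE)
        show "AE x in M. ennreal ((cmod (f x - F n x))\<^sup>2) =
            liminf (\<lambda>i. ennreal ((cmod (F (r i) x - F n x))\<^sup>2))"
          using lim
        proof eventually_elim
          case (elim x)
          then have "(\<lambda>i. ennreal ((cmod (F (r i) x - F n x))\<^sup>2)) \<longlonglongrightarrow> ennreal ((cmod (f x - F n x))\<^sup>2)"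
            by (intro tendsto_intros)
          from lim_imp_Liminf[OF sequentially_bot this] show ?case by (rule sym)
        qed
      qed
      also have "\<dots> \<le> liminf (\<lambda>i. \<integral>\<^sup>+x. ennreal ((cmod (F (r i) x - F n x))\<^sup>2) \<partial>M)"
        by (rule nn_integral_liminf) measurable
      also have "\<dots> \<le> ennreal \<epsilon>"
      proof (rule Liminf_le)
        show "\<forall>\<^sub>F i in sequentially. (\<integral>\<^sup>+x. ennreal ((cmod (F (r i) x - F n x))\<^sup>2) \<partial>M) \<le> ennreal \<epsilon>"
          using eventually_ge_at_top[of N]
        proof eventually_elim
          case (elim i)
          then have "r i \<ge> N" using seq_suble[OF r(1), of i] by simp
          then show ?case
            using N[rule_format, of "r i" n] that by (simp add: nn_integral_eq_integral[OF sq_diff] ennreal_leI)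
        qed
      qed simp
      finally show ?thesis .
    qed
    have "integrable M (\<lambda>x. (cmod (f x - F n x))\<^sup>2) \<and> (\<integral>x. (cmod (f x - F n x))\<^sup>2 \<partial>M) \<le> \<epsilon>" if "n \<ge> N" for n
    proof -
      have "integrable M (\<lambda>x. (cmod (f x - F n x))\<^sup>2)"
        using nn[OF that] by (intro integrableI_bounded) (auto simp: less_top[symmetric] top_unique elim: order.strict_trans1)
      moreover from this have "ennreal (\<integral>x. (cmod (f x - F n x))\<^sup>2 \<partial>M) \<le> ennreal \<epsilon>"
        using nn[OF that] by (simp add: nn_integral_eq_integral)
      ultimately show ?thesis using \<open>\<epsilon> > 0\<close> by (simp add: ennreal_le_iff)
    qed
    then show ?thesis by blast
  qed
  obtain N where N: "integrable M (\<lambda>x. (cmod (f x - F N x))\<^sup>2)" using tail[of 1] by auto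
  then have "L2 M (\<lambda>x. f x - F N x)" by (simp add: L2_def)
  from L2_add[OF this L2[of N]] have "L2 M f" by simp
  moreover have "(\<lambda>n. \<integral>x. (cmod (f x - F n x))\<^sup>2 \<partial>M) \<longlonglongrightarrow> 0"
  proof (rule LIMSEQ_I)
    fix \<epsilon> :: real assume "\<epsilon> > 0"
    then obtain N where "\<forall>n\<ge>N. (\<integral>x. (cmod (f x - F n x))\<^sup>2 \<partial>M) \<le> \<epsilon> / 2"
      using tail[of "\<epsilon> / 2"] by auto
    then show "\<exists>N. \<forall>n\<ge>N. norm ((\<integral>x. (cmod (f x - F n x))\<^sup>2 \<partial>M) - 0) < \<epsilon>"
      using \<open>\<epsilon> > 0\<close> by (intro exI[of _ N]) fastforce
  qed
  ultimately show thesis using that by (simp add: f_def[abs_def])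
qed

section \<open>Convolution on compact groups\<close>

locale compact_haar_group =
  fixes gmul :: "'g::{t2_space,second_countable_topology} \<Rightarrow> 'g \<Rightarrow> 'g" (infixl "\<odot>" 70)
    and ginv :: "'g \<Rightarrow> 'g" and e :: 'g and \<mu> :: "'g measure"
  assumes compact_group: "compact_group gmul ginv e"
    and haar: "haar_prob gmul \<mu>"
begin

abbreviation convol :: "('g \<Rightarrow> complex) \<Rightarrow> ('g \<Rightarrow> complex) \<Rightarrow> 'g \<Rightarrow> complex" (infixl "\<circledast>" 70)
  where "f \<circledast> h \<equiv> conv \<mu> gmul ginv f h"

section \<open>Group identities and continuity of the operations\<close>

lemma assoc: "x \<odot> y \<odot> z = x \<odot> (y \<odot> z)"
  and unit [simp]: "e \<odot> x = x" "x \<odot> e = x"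
  and inverse [simp]: "ginv x \<odot> x = e" "x \<odot> ginv x = e"
  and compact_UNIV: "compact (UNIV :: 'g set)"
  and continuous_mult': "continuous_on UNIV (\<lambda>p. fst p \<odot> snd p)"
  and continuous_inv': "continuous_on UNIV ginv"
  using compact_group by (auto simp: compact_group_def)

lemma cancel [simp]: "ginv x \<odot> (x \<odot> y) = y" "x \<odot> (ginv x \<odot> y) = y"
  by (simp_all flip: assoc)

lemma inv_unique: "x \<odot> y = e \<Longrightarrow> ginv x = y"
  by (metis assoc inverse(1) unit)

lemma inv_inv [simp]: "ginv (ginv x) = x"
  by (simp add: inv_unique)

lemma inv_unit [simp]: "ginv e = e"
  by (simp add: inv_unique)

lemma inv_mult: "ginv (x \<odot> y) = ginv y \<odot> ginv x"
  by (rule inv_unique) (simp add: assoc)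

lemma continuous_mult [continuous_intros]:
  assumes "continuous_on S a" "continuous_on S b"
  shows "continuous_on S (\<lambda>x. a x \<odot> b x)"
  using continuous_on_compose2[OF continuous_mult' continuous_on_Pair[OF assms]] by simp

lemma continuous_inv [continuous_intros]:
  assumes "continuous_on S a"
  shows "continuous_on S (\<lambda>x. ginv (a x))"
  using continuous_on_compose2[OF continuous_inv' assms] by simp

lemma continuous_comp:
  assumes "continuous_on UNIV F" "continuous_on S a"
  shows "continuous_on S (\<lambda>x. F (a x))"
  using continuous_on_compose2[OF assms] by simp

section \<open>Translation invariance and integrals of continuous functions\<close>

sublocale prob_space \<mu>
  using haar by (simp add: haar_prob_def)

lemma sets_haar [measurable_cong, simp]: "sets \<mu> = sets borel"
  using haar by (simp add: haar_prob_def)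

lemma space_haar [simp]: "space \<mu> = UNIV"
  using sets_eq_imp_space_eq[OF sets_haar] by simp

lemma prob_UNIV [simp]: "measure \<mu> UNIV = 1"
  using prob_space by simp

lemma measurable_continuous:
  "continuous_on UNIV F \<Longrightarrow> F \<in> borel_measurable \<mu>"
  using borel_measurable_continuous_onI by (simp cong: measurable_cong_sets)

lemma measurable_mult [measurable]: "(\<lambda>x. a \<odot> x) \<in> borel_measurable borel"
  by (intro borel_measurable_continuous_onI continuous_intros)

text \<open>Invariance is given for images of sets; the preimage under translation by
  \<open>a\<close> is the image under translation by \<open>ginv a\<close>, which turns it into
  invariance of the pushforward.\<close>

lemma distr_mult: "distr \<mu> borel (\<lambda>x. a \<odot> x) = \<mu>"
proof (rule measure_eqI)
  fix A assume "A \<in> sets (distr \<mu> borel (\<lambda>x. a \<odot> x))"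
  then have [measurable]: "A \<in> sets borel" by simp
  have "(\<lambda>x. a \<odot> x) -` A = (\<lambda>x. ginv a \<odot> x) ` A"
    by (auto simp: image_iff) (metis cancel(1))
  then show "emeasure (distr \<mu> borel (\<lambda>x. a \<odot> x)) A = emeasure \<mu> A"
    using haar by (simp add: emeasure_distr haar_prob_def)
qed simp

lemma integral_translate:
  fixes F :: "'g \<Rightarrow> 'b::{banach,second_countable_topology}"
  assumes [measurable]: "F \<in> borel_measurable borel"
  shows "(\<integral>x. F (a \<odot> x) \<partial>\<mu>) = (\<integral>x. F x \<partial>\<mu>)"
  using integral_distr[of "\<lambda>x. a \<odot> x" \<mu> borel F] by (simp add: distr_mult)

lemma integrable_translate:
  fixes F :: "'g \<Rightarrow> 'b::{banach,second_countable_topology}"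
  assumes "F \<in> borel_measurable borel" "integrable \<mu> F"
  shows "integrable \<mu> (\<lambda>x. F (a \<odot> x))"
  using integrable_distr_eq[of "\<lambda>x. a \<odot> x" \<mu> borel F] assms by (simp add: distr_mult)

lemma continuous_bounded:
  fixes F :: "'g \<Rightarrow> 'b::real_normed_vector"
  assumes "continuous_on UNIV F"
  shows "\<exists>B. \<forall>x. norm (F x) \<le> B"
proof -
  have "bounded (range F)"
    using compact_continuous_image[OF assms compact_UNIV] by (rule compact_imp_bounded)
  then show ?thesis by (auto simp: bounded_iff)
qed

lemma continuous_imp_integrable:
  fixes F :: "'g \<Rightarrow> 'b::{banach,second_countable_topology}"
  assumes "continuous_on UNIV F"
  shows "integrable \<mu> F"
proof -
  obtain B where "\<forall>x. norm (F x) \<le> B" using continuous_bounded[OF assms] ..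
  then have "AE x in \<mu>. norm (F x) \<le> B" by simp
  then show ?thesis by (rule integrable_const_bound) (rule measurable_continuous[OF assms])
qed

text \<open>Dominated convergence with a constant bound, available because the product of the group
  with itself is compact; sequences suffice because the group is second countable.\<close>

lemma integral_continuous:
  fixes F :: "'g \<Rightarrow> 'g \<Rightarrow> 'b::{banach,second_countable_topology}"
  assumes F: "continuous_on UNIV (\<lambda>p. F (fst p) (snd p))"
  shows "continuous_on UNIV (\<lambda>x. \<integral>h. F x h \<partial>\<mu>)"
proof (rule continuous_on_sequentiallyI)
  fix u :: "nat \<Rightarrow> 'g" and a assume u: "u \<longlonglongrightarrow> a"
  have "bounded ((\<lambda>p. F (fst p) (snd p)) ` (UNIV \<times> UNIV))"
    using F by (intro compact_imp_bounded compact_continuous_image compact_Times compact_UNIV)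
      (simp add: UNIV_Times_UNIV)
  then obtain B where B: "\<And>x h. norm (F x h) \<le> B"
    by (auto simp: bounded_iff)
  have meas: "F x \<in> borel_measurable \<mu>" for x
    using continuous_on_compose2[OF F continuous_on_Pair[OF continuous_on_const continuous_on_id, of UNIV x]]
    by (intro measurable_continuous) simp
  have lim: "(\<lambda>n. F (u n) h) \<longlonglongrightarrow> F a h" for h
  proof -
    have "continuous_on UNIV (\<lambda>x. F x h)"
      using continuous_on_compose2[OF F continuous_on_Pair[OF continuous_on_id continuous_on_const, of UNIV h]]
      by simp
    then show ?thesis using u by (auto simp: continuous_on_sequentially o_def)
  qed
  show "(\<lambda>n. \<integral>h. F (u n) h \<partial>\<mu>) \<longlonglongrightarrow> (\<integral>h. F a h \<partial>\<mu>)"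
    by (rule integral_dominated_convergence[where w="\<lambda>_. B"])
      (simp_all add: meas B lim)
qed

lemma Fubini_continuous:
  fixes F :: "'g \<Rightarrow> 'g \<Rightarrow> 'b::{banach,second_countable_topology}"
  assumes F: "continuous_on UNIV (\<lambda>p. F (fst p) (snd p))"
  shows "(\<integral>y. (\<integral>x. F x y \<partial>\<mu>) \<partial>\<mu>) = (\<integral>x. (\<integral>y. F x y \<partial>\<mu>) \<partial>\<mu>)"
proof -
  interpret P: pair_prob_space \<mu> \<mu> by unfold_locales
  have "bounded ((\<lambda>p. F (fst p) (snd p)) ` (UNIV \<times> UNIV))"
    using F by (intro compact_imp_bounded compact_continuous_image compact_Times compact_UNIV)
      (simp add: UNIV_Times_UNIV)
  then obtain B where B: "\<And>x h. norm (F x h) \<le> B"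
    by (auto simp: bounded_iff)
  \<comment> \<open>By second countability the product of the Borel sigma-algebras is the Borel
    sigma-algebra of the product, so joint continuity yields joint measurability.\<close>
  have "sets (\<mu> \<Otimes>\<^sub>M \<mu>) = sets (borel :: ('g \<times> 'g) measure)"
    using sets_pair_measure_cong[OF sets_haar sets_haar] by (simp only: borel_prod)
  moreover have "case_prod F \<in> borel_measurable borel"
    using borel_measurable_continuous_onI[OF F] by (simp only: case_prod_unfold)
  ultimately have meas: "case_prod F \<in> borel_measurable (\<mu> \<Otimes>\<^sub>M \<mu>)"
    by (simp only: measurable_def sets_eq_imp_space_eq[of "\<mu> \<Otimes>\<^sub>M \<mu>" borel])
  have "AE p in \<mu> \<Otimes>\<^sub>M \<mu>. norm (case_prod F p) \<le> B"
    using B by (simp add: case_prod_unfold)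
  then have "integrable (\<mu> \<Otimes>\<^sub>M \<mu>) (case_prod F)"
    by (rule P.P.integrable_const_bound) (rule meas)
  then show ?thesis by (rule P.Fubini_integral)
qed

text \<open>Left translates of a nonempty open set cover the group, and finitely many suffice by
  compactness. If the set were null, so would be all its translates and hence the group.\<close>

lemma open_pos:
  assumes "open U" "U \<noteq> {}"
  shows "emeasure \<mu> U > 0"
proof (rule ccontr)
  assume "\<not> ?thesis"
  then have 0: "emeasure \<mu> U = 0" by simp
  obtain u where u: "u \<in> U" using assms by blast
  define V where "V a = (\<lambda>x. a \<odot> x) -` U" for a
  have "open (V a)" for a
    unfolding V_def using assms(1) by (intro open_vimage continuous_intros)
  moreover have "x \<in> V (u \<odot> ginv x)" for x using u by (simp add: V_def assoc)
  then have "UNIV \<subseteq> (\<Union>a\<in>UNIV. V a)" by blast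
  ultimately obtain A where A: "finite A" "UNIV \<subseteq> (\<Union>a\<in>A. V a)"
    by (rule compactE_image[OF compact_UNIV]) 
  have "V a \<in> null_sets \<mu>" for a
  proof -
    have "emeasure (distr \<mu> borel (\<lambda>x. a \<odot> x)) U = emeasure \<mu> (V a)"
      using assms(1) by (subst emeasure_distr) (auto simp: V_def)
    then show ?thesis using 0 \<open>open (V a)\<close> by (simp add: distr_mult null_sets_def)
  qed
  then have "(\<Union>a\<in>A. V a) \<in> null_sets \<mu>" using A(1) by (intro null_sets.finite_UN) auto
  then have "emeasure \<mu> UNIV = 0" using A(2) by (simp add: top.extremum_unique null_sets_def)
  then show False using emeasure_space_1 by simp
qed

text \<open>The set where \<open>F\<close> differs from 0 is open, so by \<open>open_pos\<close> it
  is empty as soon as it is null.\<close>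

lemma continuous_eq_0:
  fixes F :: "'g \<Rightarrow> complex"
  assumes "continuous_on UNIV F" "(\<integral>x. (cmod (F x))\<^sup>2 \<partial>\<mu>) = 0"
  shows "F x = 0"
proof (rule ccontr)
  assume "F x \<noteq> 0"
  have "integrable \<mu> (\<lambda>x. (cmod (F x))\<^sup>2)"
    using assms(1) by (intro continuous_imp_integrable continuous_intros)
  then have "AE x in \<mu>. (cmod (F x))\<^sup>2 = 0"
    using assms(2) by (subst (asm) integral_nonneg_eq_0_iff_AE) auto
  then have "AE x in \<mu>. x \<notin> F -` (- {0})" by eventually_elim simp
  moreover have op: "open (F -` (- {0}))" using assms(1) by (intro open_vimage) auto
  ultimately have "emeasure \<mu> (F -` (- {0})) = 0"
    by (subst (asm) AE_iff_measurable[where N="F -` (- {0})"]) auto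
  moreover have "F -` (- {0}) \<noteq> {}" using \<open>F x \<noteq> 0\<close> by blast
  ultimately show False using open_pos[OF op] by simp
qed

section \<open>The convolution algebra of continuous functions\<close>

lemma continuous_convol [continuous_intros]:
  assumes "continuous_on UNIV a" "continuous_on UNIV b"
  shows "continuous_on UNIV (a \<circledast> b)"
  unfolding conv_def
  by (intro integral_continuous continuous_intros continuous_comp[OF assms(1)] continuous_comp[OF assms(2)])

lemma integrable_convol:
  fixes a b :: "'g \<Rightarrow> complex"
  assumes "continuous_on UNIV a" "continuous_on UNIV b"
  shows "integrable \<mu> (\<lambda>h. a h * b (ginv h \<odot> x))"
  by (rule continuous_imp_integrable) (intro continuous_intros continuous_comp[OF assms(2)] assms(1))

lemma convol_diff_right:
  assumes "continuous_on UNIV a" "continuous_on UNIV b" "continuous_on UNIV c"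
  shows "(a \<circledast> (\<lambda>x. b x - c x)) x = (a \<circledast> b) x - (a \<circledast> c) x"
  unfolding conv_def using assms by (simp add: right_diff_distrib integrable_convol)

lemma convol_diff_left:
  assumes "continuous_on UNIV a" "continuous_on UNIV b" "continuous_on UNIV c"
  shows "((\<lambda>x. b x - c x) \<circledast> a) x = (b \<circledast> a) x - (c \<circledast> a) x"
  unfolding conv_def using assms by (simp add: left_diff_distrib integrable_convol)

lemma convol_sum_right:
  assumes "continuous_on UNIV a" "\<And>i. continuous_on UNIV (w i)"
  shows "(a \<circledast> (\<lambda>x. \<Sum>i\<in>S. c i * w i x)) x = (\<Sum>i\<in>S. c i * (a \<circledast> w i) x)"
proof -
  have "(\<integral>h. (\<Sum>i\<in>S. c i * (a h * w i (ginv h \<odot> x))) \<partial>\<mu>) = (\<Sum>i\<in>S. c i * (a \<circledast> w i) x)"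
    unfolding conv_def using assms by (subst Bochner_Integration.integral_sum) (auto simp: integrable_convol)
  then show ?thesis by (simp add: conv_def sum_distrib_left mult_ac)
qed

lemma convol_sum_left:
  assumes "continuous_on UNIV a" "\<And>i. continuous_on UNIV (w i)"
  shows "((\<lambda>x. \<Sum>i\<in>S. c i * w i x) \<circledast> a) x = (\<Sum>i\<in>S. c i * (w i \<circledast> a) x)"
proof -
  have "(\<integral>h. (\<Sum>i\<in>S. c i * (w i h * a (ginv h \<odot> x))) \<partial>\<mu>) = (\<Sum>i\<in>S. c i * (w i \<circledast> a) x)"
    unfolding conv_def using assms by (subst Bochner_Integration.integral_sum) (auto simp: integrable_convol)
  then show ?thesis by (simp add: conv_def sum_distrib_right mult.assoc)
qed

lemma convol_assoc:
  assumes a: "continuous_on UNIV a" and b: "continuous_on UNIV b" and c: "continuous_on UNIV c"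
  shows "a \<circledast> b \<circledast> c = a \<circledast> (b \<circledast> c)"
proof
  fix x
  have [measurable]: "(\<lambda>h. b h * c (ginv h \<odot> y)) \<in> borel_measurable borel" for y
    by (intro borel_measurable_continuous_onI continuous_intros b continuous_comp[OF c])
  have "(a \<circledast> b \<circledast> c) x = (\<integral>h. (\<integral>k. a k * b (ginv k \<odot> h) * c (ginv h \<odot> x) \<partial>\<mu>) \<partial>\<mu>)"
    by (simp add: conv_def)
  also have "\<dots> = (\<integral>k. (\<integral>h. a k * b (ginv k \<odot> h) * c (ginv h \<odot> x) \<partial>\<mu>) \<partial>\<mu>)"
    by (intro Fubini_continuous continuous_intros continuous_comp[OF a] continuous_comp[OF b]
        continuous_comp[OF c])
  also have "\<dots> = (\<integral>k. a k * (\<integral>h. b h * c (ginv h \<odot> (ginv k \<odot> x)) \<partial>\<mu>) \<partial>\<mu>)"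
  proof (rule Bochner_Integration.integral_cong[OF refl])
    fix k
    have "(\<integral>h. b h * c (ginv h \<odot> (ginv k \<odot> x)) \<partial>\<mu>) =
        (\<integral>h. b (ginv k \<odot> h) * c (ginv (ginv k \<odot> h) \<odot> (ginv k \<odot> x)) \<partial>\<mu>)"
      by (rule integral_translate[symmetric]) measurable
    also have "\<dots> = (\<integral>h. b (ginv k \<odot> h) * c (ginv h \<odot> x) \<partial>\<mu>)"
      by (simp add: inv_mult assoc)
    finally show "(\<integral>h. a k * b (ginv k \<odot> h) * c (ginv h \<odot> x) \<partial>\<mu>) =
        a k * (\<integral>h. b h * c (ginv h \<odot> (ginv k \<odot> x)) \<partial>\<mu>)"
      by (simp add: mult.assoc)
  qed
  also have "\<dots> = (a \<circledast> (b \<circledast> c)) x" by (simp add: conv_def)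
  finally show "(a \<circledast> b \<circledast> c) x = (a \<circledast> (b \<circledast> c)) x" .
qed

text \<open>The involution \<open>breve\<close> reverses the order of a convolution, and here it
  fixes both factors.\<close>

lemma convol_inv:
  assumes a: "continuous_on UNIV a" "\<And>x. a (ginv x) = cnj (a x)"
    and b: "continuous_on UNIV b" "\<And>x. b (ginv x) = cnj (b x)"
  shows "(a \<circledast> b) (ginv x) = cnj ((b \<circledast> a) x)"
proof -
  have b': "b (ginv h \<odot> ginv x) = cnj (b (x \<odot> h))" for h
    using b(2)[of "x \<odot> h"] by (simp add: inv_mult)
  have a': "a (ginv x \<odot> h) = cnj (a (ginv h \<odot> x))" for h
    using a(2)[of "ginv h \<odot> x"] by (simp add: inv_mult)
  have [measurable]: "(\<lambda>h. a (ginv x \<odot> h) * cnj (b h)) \<in> borel_measurable borel"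
    by (intro borel_measurable_continuous_onI continuous_intros b continuous_comp[OF a(1)])
  have "(a \<circledast> b) (ginv x) = (\<integral>h. a (ginv x \<odot> (x \<odot> h)) * cnj (b (x \<odot> h)) \<partial>\<mu>)"
    by (simp add: conv_def b')
  also have "\<dots> = (\<integral>h. a (ginv x \<odot> h) * cnj (b h) \<partial>\<mu>)"
    by (rule integral_translate) measurable
  also have "\<dots> = (\<integral>h. cnj (b h * a (ginv h \<odot> x)) \<partial>\<mu>)"
    by (simp add: a' mult.commute)
  finally show ?thesis unfolding conv_def by (simp only: Bochner_Integration.integral_cnj)
qed

section \<open>Convolution of a square-integrable function with its adjoint\<close>

lemma L2_translate_cnj:
  assumes "L2 \<mu> f"
  shows "L2 \<mu> (\<lambda>h. cnj (f (x \<odot> h)))"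
    and "(\<integral>h. (cmod (f (x \<odot> h)))\<^sup>2 \<partial>\<mu>) = (\<integral>h. (cmod (f h))\<^sup>2 \<partial>\<mu>)"
proof -
  have [measurable]: "f \<in> borel_measurable borel"
    and int: "integrable \<mu> (\<lambda>h. (cmod (f h))\<^sup>2)"
    using assms by (simp_all add: L2_def cong: measurable_cong_sets)
  show "L2 \<mu> (\<lambda>h. cnj (f (x \<odot> h)))"
    unfolding L2_def
  proof
    have [measurable]: "cnj \<in> borel_measurable borel"
      by (intro borel_measurable_continuous_onI continuous_intros)
    show "(\<lambda>h. cnj (f (x \<odot> h))) \<in> borel_measurable \<mu>" by measurable
    show "integrable \<mu> (\<lambda>h. (cmod (cnj (f (x \<odot> h))))\<^sup>2)"
      using integrable_translate[OF _ int] by simp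
  qed
  show "(\<integral>h. (cmod (f (x \<odot> h)))\<^sup>2 \<partial>\<mu>) = (\<integral>h. (cmod (f h))\<^sup>2 \<partial>\<mu>)"
    by (rule integral_translate) measurable
qed

text \<open>Inverting \<open>ginv h \<odot> x\<close> leaves only a left translate of
  \<open>f\<close>, so left invariance of the measure controls the second factor in
  \<open>L2\<close>.\<close>

lemma convol_breve: "(f \<circledast> breve ginv f) x = (\<integral>h. f h * cnj (f (ginv x \<odot> h)) \<partial>\<mu>)"
  by (simp add: conv_def breve_def inv_mult)

text \<open>With \<open>D n = f - F n\<close>, the integrand for \<open>f\<close> is the one for
  \<open>F n\<close> plus two terms that each contain \<open>D n\<close>; Cauchy-Schwarz makes these
  small. The convergence holds at each point \<open>x\<close>, as the pointwise identity for \<phi>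
  requires.\<close>

lemma convol_breve_tendsto:
  assumes f: "L2 \<mu> f" and F: "\<And>n. L2 \<mu> (F n)" and bounded: "\<And>n. (\<integral>h. (cmod (F n h))\<^sup>2 \<partial>\<mu>) \<le> C"
    and lim: "(\<lambda>n. \<integral>h. (cmod (f h - F n h))\<^sup>2 \<partial>\<mu>) \<longlonglongrightarrow> 0"
  shows "(\<lambda>n. (F n \<circledast> breve ginv (F n)) x) \<longlonglongrightarrow> (f \<circledast> breve ginv f) x"
proof -
  define T where "T u h = cnj (u (ginv x \<odot> h))" for u :: "'g \<Rightarrow> complex" and h
  define D where "D n h = f h - F n h" for n h
  define d where "d n = (\<integral>h. (cmod (D n h))\<^sup>2 \<partial>\<mu>)" for n
  define A where "A = (\<integral>h. (cmod (f h))\<^sup>2 \<partial>\<mu>)"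
  have D: "L2 \<mu> (D n)" for n unfolding D_def by (intro L2_diff f F)
  have T: "L2 \<mu> (T u)" "(\<integral>h. (cmod (T u h))\<^sup>2 \<partial>\<mu>) = (\<integral>h. (cmod (u h))\<^sup>2 \<partial>\<mu>)" if "L2 \<mu> u" for u
    using L2_translate_cnj[OF that] by (simp_all add: T_def[abs_def])
  have bound: "cmod ((F n \<circledast> breve ginv (F n)) x - (f \<circledast> breve ginv f) x) \<le> sqrt (d n * A) + sqrt (C * d n)" for n
  proof -
    have "(f \<circledast> breve ginv f) x = (\<integral>h. (F n h * T (F n) h + D n h * T f h) + F n h * T (D n) h \<partial>\<mu>)"
      unfolding convol_breve by (rule Bochner_Integration.integral_cong) (simp_all add: T_def D_def algebra_simps)
    also have "\<dots> = (F n \<circledast> breve ginv (F n)) x + (\<integral>h. D n h * T f h \<partial>\<mu>) + (\<integral>h. F n h * T (D n) h \<partial>\<mu>)"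
      unfolding convol_breve T_def[of "F n", symmetric]
      using L2_product(1)[OF D[of n] T(1)[OF f]] L2_product(1)[OF F[of n] T(1)[OF F[of n]]]
        L2_product(1)[OF F[of n] T(1)[OF D[of n]]]
      by (simp only: Bochner_Integration.integral_add Bochner_Integration.integrable_add)
    finally have "(F n \<circledast> breve ginv (F n)) x - (f \<circledast> breve ginv f) x =
        - ((\<integral>h. D n h * T f h \<partial>\<mu>) + (\<integral>h. F n h * T (D n) h \<partial>\<mu>))"
      by (simp only: minus_add_distrib diff_diff_eq2 diff_conv_add_uminus) (simp add: algebra_simps)
    then have "cmod ((F n \<circledast> breve ginv (F n)) x - (f \<circledast> breve ginv f) x) =
        cmod ((\<integral>h. D n h * T f h \<partial>\<mu>) + (\<integral>h. F n h * T (D n) h \<partial>\<mu>))"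
      by (simp only: norm_minus_cancel)
    also have "\<dots> \<le> cmod (\<integral>h. D n h * T f h \<partial>\<mu>) + cmod (\<integral>h. F n h * T (D n) h \<partial>\<mu>)"
      by (rule norm_triangle_ineq)
    also have "\<dots> \<le> sqrt (d n * A) + sqrt ((\<integral>h. (cmod (F n h))\<^sup>2 \<partial>\<mu>) * d n)"
      using L2_product(2)[OF D T(1)[OF f], of n] L2_product(2)[OF F T(1)[OF D], of n n]
      by (simp add: T(2) f D d_def A_def)
    also have "\<dots> \<le> sqrt (d n * A) + sqrt (C * d n)"
      using bounded[of n] by (simp add: d_def mult_right_mono)
    finally show ?thesis .
  qed
  have d: "d \<longlonglongrightarrow> 0" using lim by (simp add: d_def[abs_def] D_def)
  have "(\<lambda>n. sqrt (d n * A) + sqrt (C * d n)) \<longlonglongrightarrow> sqrt (0 * A) + sqrt (C * 0)"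
    by (intro tendsto_intros d)
  then have "(\<lambda>n. (F n \<circledast> breve ginv (F n)) x - (f \<circledast> breve ginv f) x) \<longlonglongrightarrow> 0"
    by (intro Lim_null_comparison[OF always_eventually[OF allI[OF bound]]]) simp
  then show ?thesis by (simp add: LIM_zero_iff)
qed

section \<open>Positive definite functions\<close>

lemma L2_continuous:
  assumes "continuous_on UNIV a"
  shows "L2 \<mu> a"
  using assms unfolding L2_def
  by (intro conjI measurable_continuous continuous_imp_integrable continuous_intros)

lemma pd_unit:
  assumes "positive_definite gmul ginv \<phi>"
  shows "\<phi> e = complex_of_real (Re (\<phi> e))" "Re (\<phi> e) \<ge> 0"
  using assms[unfolded positive_definite_def, rule_format, of "\<lambda>_. e" "\<lambda>_. 1" 1]
  by (auto simp: Let_def complex_eq_iff)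

text \<open>The quadratic form at the points \<open>e\<close> and \<open>x\<close> with weights 1
  and \<open>t\<close>. Special values of \<open>t\<close> yield Hermitian symmetry and the bound by
  the value at the unit.\<close>

lemma pd_two_points:
  assumes "positive_definite gmul ginv \<phi>"
  defines "s \<equiv> \<lambda>x t. \<phi> e + \<phi> x * t + \<phi> (ginv x) * cnj t + \<phi> e * cnj t * t"
  shows "Im (s x t) = 0" "Re (s x t) \<ge> 0"
  using assms(1)[unfolded positive_definite_def, rule_format, 
    of "\<lambda>i. if i = 0 then e else x" "\<lambda>i. if i = 0 then 1 else t" 2]
  by (simp_all add: s_def Let_def eval_nat_numeral algebra_simps)

text \<open>Vanishing of the imaginary part for \<open>t = 1\<close> compares the imaginary parts of
  the two values; for \<open>t = \<i>\<close> it compares their real parts.\<close>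

lemma pd_inv:
  assumes "positive_definite gmul ginv \<phi>"
  shows "\<phi> (ginv x) = cnj (\<phi> x)"
  using pd_two_points(1)[OF assms, of x 1] pd_two_points(1)[OF assms, of x \<i>] pd_unit(1)[OF assms]
  by (auto simp: complex_eq_iff)

lemma pd_bound:
  assumes pd: "positive_definite gmul ginv \<phi>"
  shows "cmod (\<phi> x) \<le> Re (\<phi> e)"
proof (cases "\<phi> x = 0")
  case False
  \<comment> \<open>This phase turns both cross terms into \<open>- cmod (\<phi> x)\<close>, so that
    the form becomes twice the difference of the two sides of the claim.\<close>
  define t where "t = - cnj (sgn (\<phi> x))"
  have t: "cnj t * t = 1" and 1: "\<phi> x * t = - complex_of_real (cmod (\<phi> x))"
    using False by (simp_all add: t_def sgn_eq complex_norm_square[symmetric] power2_eq_square mult.commute)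
  have 2: "\<phi> (ginv x) * cnj t = - complex_of_real (cmod (\<phi> x))"
    using arg_cong[OF 1, of cnj] by (simp add: pd_inv[OF pd])
  show ?thesis using pd_two_points(2)[OF pd, of x t] t by (simp add: 1 2 mult.assoc)
qed (use pd_unit[OF pd] in simp)

text \<open>The points \<open>y i\<close> with weights \<open>\<eta> i\<close> are kept, and the quadratic form is averaged over
  \<open>m\<close> further independent Haar distributed points \<open>x\<close> with weights \<open>\<xi> x\<close>.\<close>

lemma pd_integrate:
  fixes m n :: nat and y :: "nat \<Rightarrow> 'g" and \<eta> :: "nat \<Rightarrow> complex"
  assumes pd: "positive_definite gmul ginv \<phi>" and \<phi>: "continuous_on UNIV \<phi>"
    and \<xi>: "continuous_on UNIV \<xi>"
  defines "\<Xi> \<equiv> \<lambda>y. \<integral>x. \<phi> (ginv y \<odot> x) * \<xi> x \<partial>\<mu>"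
  shows "0 \<le> Re (\<Sum>i<n. \<Sum>j<n. \<phi> (ginv (y i) \<odot> y j) * cnj (\<eta> i) * \<eta> j)
    + 2 * m * Re (\<Sum>i<n. cnj (\<eta> i) * \<Xi> (y i))
    + m * (Re (\<phi> e) * (\<integral>x. (cmod (\<xi> x))\<^sup>2 \<partial>\<mu>))
    + m * (real m - 1) * Re (\<integral>x. cnj (\<xi> x) * \<Xi> x \<partial>\<mu>)"
proof (induction m arbitrary: n y \<eta>)
  case 0
  show ?case
    using pd[unfolded positive_definite_def, rule_format, of y \<eta> n] by (simp add: Let_def)
next
  case (Suc m)
  \<comment> \<open>\<open>J\<close> is the contribution of an averaged point paired with itself,
    which occurs \<open>m\<close> times; \<open>I\<close> is that of an ordered pair of distinct
    averaged points, of which there are \<open>m * (m - 1)\<close>.\<close>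
  define J where "J = Re (\<phi> e) * (\<integral>x. (cmod (\<xi> x))\<^sup>2 \<partial>\<mu>)"
  define I where "I = Re (\<integral>x. cnj (\<xi> x) * \<Xi> x \<partial>\<mu>)"
  define Q where "Q = Re (\<Sum>i<n. \<Sum>j<n. \<phi> (ginv (y i) \<odot> y j) * cnj (\<eta> i) * \<eta> j)"
  define C where "C = Re (\<Sum>i<n. cnj (\<eta> i) * \<Xi> (y i))"
  define c where "c x = (\<Sum>i<n. cnj (\<eta> i) * (\<phi> (ginv (y i) \<odot> x) * \<xi> x))" for x
  have cont: "continuous_on UNIV (\<lambda>x. \<phi> (ginv a \<odot> x) * \<xi> x)" for a
    by (intro continuous_intros continuous_comp[OF \<phi>] \<xi>)
  have cont_\<Xi>: "continuous_on UNIV \<Xi>"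
    unfolding \<Xi>_def
    by (intro integral_continuous continuous_intros continuous_comp[OF \<phi>] continuous_comp[OF \<xi>])
  have cont_c: "continuous_on UNIV c"
    unfolding c_def by (intro continuous_intros cont)
  have int_c: "(\<integral>x. Re (c x) \<partial>\<mu>) = C"
  proof -
    have "(\<integral>x. c x \<partial>\<mu>) = (\<Sum>i<n. cnj (\<eta> i) * \<Xi> (y i))"
      unfolding c_def \<Xi>_def
      using continuous_imp_integrable[OF cont]
      by (subst Bochner_Integration.integral_sum) auto
    then show ?thesis using continuous_imp_integrable[OF cont_c] by (simp add: C_def)
  qed
  \<comment> \<open>The induction hypothesis is applied with \<open>x\<close> as a further kept
    point of weight \<open>\<xi> x\<close>; integrating over \<open>x\<close> then makes it an
    averaged point. Hence \<open>n\<close>, \<open>y\<close> and \<eta> are generalized in the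
    induction.\<close>
  have ge: "0 \<le> (Q + 2 * m * C + m * J + m * (real m - 1) * I) + 2 * Re (c x)
      + Re (\<phi> e) * (cmod (\<xi> x))\<^sup>2 + 2 * m * Re (cnj (\<xi> x) * \<Xi> x)" for x
  proof -
    define y' where "y' = y(n := x)"
    define \<eta>' where "\<eta>' = \<eta>(n := \<xi> x)"
    have y': "y' n = x" "\<And>i. i < n \<Longrightarrow> y' i = y i" and \<eta>': "\<eta>' n = \<xi> x" "\<And>i. i < n \<Longrightarrow> \<eta>' i = \<eta> i"
      by (auto simp: y'_def \<eta>'_def)
    have flip: "\<phi> (ginv x \<odot> z) = cnj (\<phi> (ginv z \<odot> x))" for z
      using pd_inv[OF pd, of "ginv z \<odot> x"] by (simp add: inv_mult)
    have "(\<Sum>i<Suc n. \<Sum>j<Suc n. \<phi> (ginv (y' i) \<odot> y' j) * cnj (\<eta>' i) * \<eta>' j) =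
      (\<Sum>i<n. \<Sum>j<n. \<phi> (ginv (y i) \<odot> y j) * cnj (\<eta> i) * \<eta> j) + c x + cnj (c x)
      + \<phi> e * (cnj (\<xi> x) * \<xi> x)"
      by (simp add: y' \<eta>' c_def sum.distrib flip mult_ac)
    moreover have "cnj (\<xi> x) * \<xi> x = complex_of_real ((cmod (\<xi> x))\<^sup>2)"
      using complex_norm_square[of "\<xi> x"] by (simp add: mult.commute)
    ultimately have "Re (\<Sum>i<Suc n. \<Sum>j<Suc n. \<phi> (ginv (y' i) \<odot> y' j) * cnj (\<eta>' i) * \<eta>' j) =
      Q + 2 * Re (c x) + Re (\<phi> e) * (cmod (\<xi> x))\<^sup>2"
      by (simp add: Q_def)
    moreover have "Re (\<Sum>i<Suc n. cnj (\<eta>' i) * \<Xi> (y' i)) = C + Re (cnj (\<xi> x) * \<Xi> x)"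
      by (simp add: y' \<eta>' C_def)
    ultimately show ?thesis
      using Suc.IH[of y' \<eta>' "Suc n", folded J_def I_def] by (simp only: algebra_simps)
  qed
  have int: "integrable \<mu> (\<lambda>x. cnj (\<xi> x) * \<Xi> x)" "integrable \<mu> (\<lambda>x. (cmod (\<xi> x))\<^sup>2)" "integrable \<mu> c"
    by (intro continuous_imp_integrable continuous_intros \<xi> cont_\<Xi> cont_c)+
  have int_I: "(\<integral>x. Re (cnj (\<xi> x) * \<Xi> x) \<partial>\<mu>) = I"
    unfolding I_def using int(1) by (rule integral_Re)
  have "0 \<le> (\<integral>x. (Q + 2 * m * C + m * J + m * (real m - 1) * I) + 2 * Re (c x)
      + Re (\<phi> e) * (cmod (\<xi> x))\<^sup>2 + 2 * m * Re (cnj (\<xi> x) * \<Xi> x) \<partial>\<mu>)"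
    using ge by (intro integral_nonneg_AE always_eventually allI)
  also have "\<dots> = (Q + 2 * m * C + m * J + m * (real m - 1) * I) + 2 * C + J + 2 * m * I"
    using int(2,3) integrable_Re[OF int(1)]
    by (simp add: int_c int_I J_def del: times_complex.sel)
  finally show ?case
    unfolding J_def[symmetric] I_def[symmetric] Q_def[symmetric] C_def[symmetric]
    by (simp add: algebra_simps)
qed

text \<open>This is positive definiteness tested against the measure \<open>\<delta>\<^sub>e - r dg\<close>: place mass \<open>m\<close> at the
  unit, average over \<open>m\<close> further points, and let \<open>m\<close> tend to infinity.\<close>

lemma pd_atom:
  assumes pd: "positive_definite gmul ginv \<phi>" and \<phi>: "continuous_on UNIV \<phi>"
    and r: "continuous_on UNIV r" "\<And>x. r (ginv x) = cnj (r x)"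
  shows "0 \<le> Re (\<phi> e) - 2 * Re ((\<phi> \<circledast> r) e) + Re ((r \<circledast> (\<phi> \<circledast> r)) e)"
proof -
  \<comment> \<open>Since \<open>r\<close> is Hermitian, this weight is \<open>- r (ginv x)\<close>,
    which is what makes \<open>\<Xi>\<close> a convolution with \<open>r\<close>.\<close>
  define \<xi> where "\<xi> x = - cnj (r x)" for x
  define \<Xi> where "\<Xi> y = (\<integral>x. \<phi> (ginv y \<odot> x) * \<xi> x \<partial>\<mu>)" for y
  define J where "J = Re (\<phi> e) * (\<integral>x. (cmod (\<xi> x))\<^sup>2 \<partial>\<mu>)"
  define I where "I = Re (\<integral>x. cnj (\<xi> x) * \<Xi> x \<partial>\<mu>)"
  have \<xi>: "continuous_on UNIV \<xi>" unfolding \<xi>_def by (intro continuous_intros r)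
  have \<Xi>: "\<Xi> y = - (\<phi> \<circledast> r) (ginv y)" for y
  proof -
    have [measurable]: "(\<lambda>x. \<phi> x * r (ginv x \<odot> ginv y)) \<in> borel_measurable borel"
      by (intro borel_measurable_continuous_onI continuous_intros \<phi> continuous_comp[OF r(1)])
    have "(\<phi> \<circledast> r) (ginv y) = (\<integral>x. \<phi> (ginv y \<odot> x) * r (ginv (ginv y \<odot> x) \<odot> ginv y) \<partial>\<mu>)"
      unfolding conv_def by (rule integral_translate[symmetric]) measurable
    also have "\<dots> = - \<Xi> y" by (simp add: \<Xi>_def \<xi>_def inv_mult assoc r(2))
    finally show ?thesis by simp
  qed
  have I: "I = Re ((r \<circledast> (\<phi> \<circledast> r)) e)"
    by (simp add: I_def \<Xi> \<xi>_def conv_def[of _ _ _ r])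
  \<comment> \<open>After division by \<open>(real m)\<^sup>2\<close> the self-pairings of averaged
    points enter only through \<open>(J - I) / real m\<close>, which disappears in the
    limit.\<close>
  have "0 \<le> (Re (\<phi> e) + 2 * Re (\<Xi> e) + I) + (J - I) / real m" if "m > 0" for m
  proof -
    have "0 \<le> (real m)\<^sup>2 * Re (\<phi> e) + 2 * m * (m * Re (\<Xi> e)) + m * J + m * (real m - 1) * I"
      using pd_integrate[OF pd \<phi> \<xi>, where n=1 and y="\<lambda>_. e" and \<eta>="\<lambda>_. of_nat m" and m=m, folded \<Xi>_def J_def I_def]
      by (simp add: J_def I_def \<Xi>_def power2_eq_square mult_ac)
    also have "\<dots> = (real m)\<^sup>2 * ((Re (\<phi> e) + 2 * Re (\<Xi> e) + I) + (J - I) / real m)"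
      using that by (simp add: field_simps power2_eq_square)
    finally show ?thesis using that by (simp add: zero_le_mult_iff)
  qed
  then have "\<forall>m\<ge>1. 0 \<le> (Re (\<phi> e) + 2 * Re (\<Xi> e) + I) + (J - I) / real m" by simp
  moreover have "(\<lambda>m. (Re (\<phi> e) + 2 * Re (\<Xi> e) + I) + (J - I) / real m) \<longlonglongrightarrow>
      (Re (\<phi> e) + 2 * Re (\<Xi> e) + I) + 0"
    by (intro tendsto_intros lim_const_over_n)
  ultimately have "0 \<le> (Re (\<phi> e) + 2 * Re (\<Xi> e) + I) + 0"
    by (intro LIMSEQ_le_const) auto
  then show ?thesis by (simp add: \<Xi> I)
qed

text \<open>The bound on \<phi> bounds \<open>\<phi> \<circledast> w\<close> pointwise by the
  \<open>L1\<close> norm \<open>N\<close> of \<open>w\<close>, so the left side is at most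
  \<open>N\<^sup>2\<close>, which is at most the squared \<open>L2\<close> norm because the total
  mass is 1. This supplies the odd case of \<open>a_nonneg\<close>.\<close>

lemma convol_contraction:
  assumes \<phi>: "continuous_on UNIV \<phi>" "\<And>x. cmod (\<phi> x) \<le> 1"
    and w: "continuous_on UNIV w" "\<And>x. w (ginv x) = cnj (w x)"
  shows "cmod ((w \<circledast> (\<phi> \<circledast> w)) e) \<le> (\<integral>x. (cmod (w x))\<^sup>2 \<partial>\<mu>)"
proof -
  define N where "N = (\<integral>x. cmod (w x) \<partial>\<mu>)"
  have int: "integrable \<mu> (\<lambda>x. cmod (w x))" "integrable \<mu> (\<lambda>x. (cmod (w x))\<^sup>2)"
    by (intro continuous_imp_integrable continuous_intros w)+
  have inner: "cmod ((\<phi> \<circledast> w) (ginv x)) \<le> N" for x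
  proof -
    \<comment> \<open>Hermitian symmetry replaces the inverted argument by the left translate
      \<open>x \<odot> h\<close>, to which invariance of the measure applies.\<close>
    have w': "cmod (w (ginv h \<odot> ginv x)) = cmod (w (x \<odot> h))" for h
      using w(2)[of "x \<odot> h"] by (simp add: inv_mult)
    have "cmod ((\<phi> \<circledast> w) (ginv x)) \<le> (\<integral>h. cmod (\<phi> h * w (ginv h \<odot> ginv x)) \<partial>\<mu>)"
      unfolding conv_def by (rule integral_norm_bound)
    also have "\<dots> \<le> (\<integral>h. cmod (w (x \<odot> h)) \<partial>\<mu>)"
      using \<phi>(2) mult_right_mono[OF \<phi>(2) norm_ge_zero, of _ "w _"]
      by (intro integral_mono integrable_norm integrable_convol \<phi> w
          continuous_imp_integrable continuous_intros continuous_comp[OF w(1)])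
        (auto simp: norm_mult w')
    also have "\<dots> = N"
      unfolding N_def by (intro integral_translate borel_measurable_continuous_onI continuous_intros w)
    finally show ?thesis .
  qed
  have cont: "continuous_on UNIV (\<lambda>x. w x * (\<phi> \<circledast> w) (ginv x))"
    by (intro continuous_intros w continuous_comp[OF continuous_convol[OF \<phi>(1) w(1)]])
  have "cmod ((w \<circledast> (\<phi> \<circledast> w)) e) \<le> (\<integral>x. cmod (w x * (\<phi> \<circledast> w) (ginv x)) \<partial>\<mu>)"
    unfolding conv_def[of _ _ _ w] using integral_norm_bound by simp
  also have "\<dots> \<le> (\<integral>x. cmod (w x) * N \<partial>\<mu>)"
    using inner by (intro integral_mono integrable_norm continuous_imp_integrable[OF cont])
      (auto simp: norm_mult int mult_left_mono)
  also have "\<dots> = N\<^sup>2" by (simp add: N_def power2_eq_square)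
  also have "\<dots> \<le> (\<integral>x. (cmod (w x))\<^sup>2 \<partial>\<mu>)"
  proof -
    \<comment> \<open>The right side is the variance of \<open>cmod (w x)\<close>.\<close>
    have "0 \<le> (\<integral>x. (cmod (w x) - N)\<^sup>2 \<partial>\<mu>)" by simp
    also have "\<dots> = (\<integral>x. (cmod (w x))\<^sup>2 \<partial>\<mu>) - N\<^sup>2"
      using int by (simp add: power2_diff flip: N_def) (simp add: power2_eq_square)
    finally show ?thesis by simp
  qed
  finally show ?thesis .
qed

end

section \<open>The convolution square root\<close>

locale normalized_pd_function = compact_haar_group +
  fixes \<phi> :: "'a \<Rightarrow> complex"
  assumes continuous_\<phi>: "continuous_on UNIV \<phi>"
    and pd: "positive_definite gmul ginv \<phi>"
    and normalized: "Re (\<phi> e) \<le> 1"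
begin

text \<open>If \<open>t\<close> stands for \<open>\<phi>\<close> in the convolution algebra, then \<open>w j\<close> is \<open>t (1 - t)\<^sup>j\<close> and
  \<open>v m\<close> is \<open>t\<^sup>2 (1 - t)\<^sup>m\<close>.\<close>

primrec w :: "nat \<Rightarrow> 'a \<Rightarrow> complex" where
  "w 0 = \<phi>"
| "w (Suc j) = (\<lambda>x. w j x - (\<phi> \<circledast> w j) x)"

definition v :: "nat \<Rightarrow> 'a \<Rightarrow> complex"
  where "v m = (\<lambda>x. w m x - w (Suc m) x)"

definition a :: "nat \<Rightarrow> real"
  where "a m = Re (v m e)"

lemma continuous_w: "continuous_on UNIV (w j)"
  by (induction j) (auto intro!: continuous_intros continuous_\<phi>)

lemma continuous_v: "continuous_on UNIV (v m)"
  unfolding v_def by (intro continuous_intros continuous_w)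

lemma phi_convol_w: "\<phi> \<circledast> w m = v m"
  by (rule ext) (simp add: v_def)

lemma phi_convol_v: "(\<phi> \<circledast> v m) x = v m x - v (Suc m) x"
proof -
  have "(\<phi> \<circledast> v m) x = (\<phi> \<circledast> w m) x - (\<phi> \<circledast> w (Suc m)) x"
    unfolding v_def by (intro convol_diff_right continuous_\<phi> continuous_w)
  then show ?thesis by (simp only: phi_convol_w)
qed

text \<open>The right side depends only on \<open>i + j\<close>, so the \<open>w j\<close> commute
  with each other and with \<open>\<phi> = w 0\<close> although the group may be noncommutative.
  This commutation makes every \<open>w j\<close> Hermitian.\<close>

lemma w_convol_w: "w i \<circledast> w j = v (i + j)"
proof (induction i)
  case 0
  then show ?case by (simp add: phi_convol_w)
next
  case (Suc i)
  have "(w (Suc i) \<circledast> w j) x = v (Suc i + j) x" for x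
  proof -
    have "(w (Suc i) \<circledast> w j) x = (w i \<circledast> w j) x - (\<phi> \<circledast> w i \<circledast> w j) x"
      unfolding w.simps
      by (intro convol_diff_left continuous_w continuous_convol continuous_\<phi>)
    also have "\<phi> \<circledast> w i \<circledast> w j = \<phi> \<circledast> v (i + j)"
      by (simp only: convol_assoc continuous_w continuous_\<phi> Suc.IH)
    finally show ?thesis by (simp add: Suc.IH phi_convol_v)
  qed
  then show ?case by auto
qed

lemma w_inv: "w j (ginv x) = cnj (w j x)"
proof (induction j arbitrary: x)
  case 0
  show ?case by (simp add: pd_inv[OF pd])
next
  case (Suc j)
  have "(\<phi> \<circledast> w j) (ginv x) = cnj ((w j \<circledast> w 0) x)"
    unfolding w.simps(1) by (intro convol_inv continuous_w continuous_\<phi> Suc.IH pd_inv[OF pd])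
  also have "w j \<circledast> w 0 = \<phi> \<circledast> w j"
    by (simp only: w_convol_w phi_convol_w add_0_right)
  finally show ?case by (simp add: Suc.IH)
qed

section \<open>Nonnegativity of the values at the unit and convergence of the series\<close>

lemma hermitian_square_unit:
  assumes "\<And>x. g (ginv x) = cnj (g x)"
  shows "(g \<circledast> g) e = of_real (\<integral>x. (cmod (g x))\<^sup>2 \<partial>\<mu>)"
proof -
  have "(g \<circledast> g) e = (\<integral>x. of_real ((cmod (g x))\<^sup>2) \<partial>\<mu>)"
    unfolding conv_def
    by (rule Bochner_Integration.integral_cong) (simp_all only: unit assms complex_norm_square)
  then show ?thesis by (simp only: integral_complex_of_real)
qed

lemma a_double: "a (2 * k) = (\<integral>x. (cmod (w k x))\<^sup>2 \<partial>\<mu>)"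
  using hermitian_square_unit[of "w k", OF w_inv] by (simp add: a_def w_convol_w mult_2)

text \<open>Even indices give squared \<open>L2\<close> norms. For odd ones,
  \<open>a (2 * k) - a (2 * k + 1)\<close> is the real part of
  \<open>(w k \<circledast> (\<phi> \<circledast> w k)) e\<close>, which
  \<open>convol_contraction\<close> bounds by \<open>a (2 * k)\<close> because
  \<open>cmod (\<phi> x) \<le> 1\<close>.\<close>

lemma a_nonneg: "a m \<ge> 0"
proof (cases "even m")
  case True
  then obtain k where "m = 2 * k" by (rule evenE)
  then show ?thesis by (simp add: a_double)
next
  case False
  then obtain k where "m = 2 * k + 1" by (rule oddE)
  then have m: "m = Suc (2 * k)" by simp
  have "(w k \<circledast> (\<phi> \<circledast> w k)) e = (w k \<circledast> (\<lambda>x. w k x - w (Suc k) x)) e"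
    by (simp only: phi_convol_w v_def)
  also have "\<dots> = (w k \<circledast> w k) e - (w k \<circledast> w (Suc k)) e"
    by (intro convol_diff_right continuous_w)
  also have "\<dots> = v (2 * k) e - v m e"
    by (simp only: w_convol_w m mult_2 add_Suc_right)
  finally have "Re ((w k \<circledast> (\<phi> \<circledast> w k)) e) = a (2 * k) - a m" by (simp add: a_def)
  moreover have "cmod ((w k \<circledast> (\<phi> \<circledast> w k)) e) \<le> a (2 * k)"
    unfolding a_double using pd_bound[OF pd] normalized
    by (intro convol_contraction continuous_\<phi> continuous_w w_inv) (rule order_trans)
  ultimately show ?thesis
    using complex_Re_le_cmod[of "(w k \<circledast> (\<phi> \<circledast> w k)) e"] by linarith
qed

text \<open>As \<open>v (i + j)\<close> is the convolution of \<open>w i\<close> and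
  \<open>w j\<close>, Cauchy-Schwarz bounds it by their \<open>L2\<close> norms uniformly in
  \<open>x\<close>. Passing to the arithmetic mean makes the bound linear in \<open>a\<close>, hence
  summable along with it.\<close>

lemma v_bound: "cmod (v (i + j) x) \<le> (a (2 * i) + a (2 * j)) / 2"
proof -
  have flip: "w j (ginv h \<odot> x) = cnj (w j (ginv x \<odot> h))" for h
    using w_inv[of j "ginv x \<odot> h"] by (simp add: inv_mult)
  have "(\<integral>h. (cmod (w j (ginv h \<odot> x)))\<^sup>2 \<partial>\<mu>) = a (2 * j)"
    unfolding flip complex_mod_cnj a_double
    by (intro integral_translate borel_measurable_continuous_onI continuous_intros continuous_w)
  moreover have "v (i + j) x = (\<integral>h. w i h * w j (ginv h \<odot> x) \<partial>\<mu>)"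
    by (simp only: w_convol_w[symmetric] conv_def)
  ultimately have "cmod (v (i + j) x) \<le> sqrt (a (2 * i) * a (2 * j))"
    using L2_product(2)[of \<mu> "w i" "\<lambda>h. w j (ginv h \<odot> x)"]
    by (simp add: L2_continuous continuous_w continuous_comp[OF continuous_w] continuous_intros a_double)
  then show ?thesis
    using arith_geo_mean_sqrt[of "a (2 * i)" "a (2 * j)"] a_nonneg by fastforce
qed

lemma sum_a: "(\<Sum>m<n. a m) = Re (\<phi> e) - Re (w n e)"
  using sum_lessThan_telescope'[of "\<lambda>m. Re (w m e)" n] by (simp add: a_def v_def del: w.simps(2))

text \<open>Here \<open>r\<close> is \<open>1 - (1 - t)\<^sup>k\<close>, so that \<open>w (2 * k)\<close> is \<open>(1 - r) t (1 - r)\<close>.\<close>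

lemma w_unit_nonneg: "0 \<le> Re (w (2 * k) e)"
proof -
  \<comment> \<open>The factor 1 gives the sum the weighted shape that
    \<open>convol_sum_left\<close> and \<open>convol_sum_right\<close> match.\<close>
  define r where "r = (\<lambda>x. \<Sum>j<k. 1 * w j x)"
  have r: "continuous_on UNIV r" "\<And>x. r (ginv x) = cnj (r x)"
    unfolding r_def by (auto intro!: continuous_intros continuous_w simp: w_inv)
  have sum_v: "(\<Sum>j<k. 1 * v (j + l) x) = w l x - w (k + l) x" for l x
    using sum_lessThan_telescope'[of "\<lambda>j. w (j + l) x" k] by (simp add: v_def)
  have \<phi>r: "\<phi> \<circledast> r = (\<lambda>x. \<phi> x - w k x)"
  proof
    fix x
    have "(\<phi> \<circledast> r) x = (\<Sum>j<k. 1 * (\<phi> \<circledast> w j) x)"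
      unfolding r_def by (intro convol_sum_right continuous_\<phi> continuous_w)
    then show "(\<phi> \<circledast> r) x = \<phi> x - w k x" using sum_v[of 0 x] by (simp add: phi_convol_w)
  qed
  have rw: "(r \<circledast> w l) x = w l x - w (k + l) x" for l x
  proof -
    have "(r \<circledast> w l) x = (\<Sum>j<k. 1 * (w j \<circledast> w l) x)"
      unfolding r_def by (intro convol_sum_left continuous_w)
    then show ?thesis by (simp only: w_convol_w sum_v)
  qed
  have "(r \<circledast> (\<phi> \<circledast> r)) e = (r \<circledast> w 0) e - (r \<circledast> w k) e"
    unfolding \<phi>r w.simps(1) by (intro convol_diff_right r continuous_\<phi> continuous_w)
  then have "(r \<circledast> (\<phi> \<circledast> r)) e = (w 0 e - w k e) - (w k e - w (2 * k) e)"
    by (simp only: rw add_0_right mult_2)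
  then show ?thesis
    using pd_atom[OF pd continuous_\<phi> r] unfolding \<phi>r by simp
qed

lemma summable_a: "summable a"
proof (rule bounded_imp_summable)
  fix n
  \<comment> \<open>The sum is extended to an even number of terms because
    \<open>w_unit_nonneg\<close> controls the telescoped remainder at even indices only.\<close>
  have "sum a {..n} \<le> sum a {..<2 * Suc n}"
    by (intro sum_mono2) (auto simp: a_nonneg)
  also have "\<dots> \<le> Re (\<phi> e)"
    using w_unit_nonneg[of "Suc n"] unfolding sum_a by simp
  finally show "sum a {..n} \<le> Re (\<phi> e)" .
qed (rule a_nonneg)

text \<open>One expression for both parities: an even \<open>m\<close> splits into equal halves and
  needs only \<open>a m\<close>, an odd \<open>m\<close> splits into unequal ones and needs the two
  neighbours. At 0 the truncated \<open>m - 1\<close> merely repeats \<open>a 0\<close>.\<close>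

definition v_majorant :: "nat \<Rightarrow> real"
  where "v_majorant m = a m + a (m - 1) + a (Suc m)"

lemma v_le_majorant: "cmod (v m x) \<le> v_majorant m"
proof -
  define i j where "i = m div 2" and "j = m - i"
  have ij: "i + j = m" by (simp add: i_def j_def)
  have "(2 * i = m \<and> 2 * j = m) \<or> (2 * i = m - 1 \<and> 2 * j = Suc m)"
    unfolding i_def j_def by presburger
  then have "(a (2 * i) + a (2 * j)) / 2 \<le> v_majorant m"
    using a_nonneg[of m] a_nonneg[of "m - 1"] a_nonneg[of "Suc m"] by (auto simp: v_majorant_def)
  with v_bound[of i j x, unfolded ij] show ?thesis by (rule order_trans)
qed

lemma summable_majorant: "summable v_majorant"
proof -
  have "summable (\<lambda>m. a (m - 1))"
    using summable_a summable_Suc_iff[of "\<lambda>m. a (m - 1)"] by simp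
  then show ?thesis
    unfolding v_majorant_def[abs_def] using summable_a by (intro summable_add) (simp_all add: summable_Suc_iff)
qed

lemma summable_v: "summable (\<lambda>m. cmod (v m x))"
  using summable_majorant by (rule summable_comparison_test') (simp add: v_le_majorant)

text \<open>The sum \<open>s\<close> is continuous by the Weierstrass test, and the telescoped
  remainders \<open>w n\<close> tend boundedly to \<open>\<phi> - s\<close>. Their squared
  \<open>L2\<close> norms are \<open>a (2 * n)\<close> and tend to 0, so \<open>\<phi> - s\<close>
  has norm 0 and vanishes everywhere by continuity.\<close>

lemma suminf_v: "(\<Sum>m. v m x) = \<phi> x"
proof -
  have sum_v: "(\<Sum>m<n. v m x) = \<phi> x - w n x" for n x
    using sum_lessThan_telescope'[of "\<lambda>m. w m x" n] by (simp add: v_def del: w.simps(2))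
  define s where "s x = (\<Sum>m. v m x)" for x
  have "uniform_limit UNIV (\<lambda>n x. \<Sum>m<n. v m x) s sequentially"
    unfolding s_def[abs_def] by (intro Weierstrass_m_test[where M=v_majorant] v_le_majorant summable_majorant)
  then have cont: "continuous_on UNIV s"
    by (rule uniform_limit_theorem[rotated])
      (auto intro!: always_eventually continuous_intros continuous_v)
  have lim: "(\<lambda>n. w n x) \<longlonglongrightarrow> \<phi> x - s x" for x
  proof -
    have "(\<lambda>n. \<Sum>m<n. v m x) \<longlonglongrightarrow> s x"
      unfolding s_def by (intro summable_LIMSEQ summable_norm_cancel[OF summable_v])
    then have "(\<lambda>n. \<phi> x - (\<Sum>m<n. v m x)) \<longlonglongrightarrow> \<phi> x - s x" by (intro tendsto_intros)
    then show ?thesis by (simp add: sum_v)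
  qed
  define B where "B = 1 + suminf v_majorant"
  have w_le: "cmod (w n x) \<le> B" for n x
  proof -
    have "cmod (\<Sum>m<n. v m x) \<le> (\<Sum>m<n. v_majorant m)"
      by (rule order.trans[OF norm_sum]) (intro sum_mono v_le_majorant)
    also have "\<dots> \<le> suminf v_majorant"
      by (intro sum_le_suminf summable_majorant) (auto simp: v_majorant_def a_nonneg)
    finally have "cmod (\<phi> x - w n x) \<le> suminf v_majorant" by (simp add: sum_v)
    moreover have "cmod (\<phi> x) \<le> 1" using pd_bound[OF pd, of x] normalized by simp
    moreover have "cmod (w n x) \<le> cmod (\<phi> x) + cmod (\<phi> x - w n x)"
      by (metis norm_triangle_sub norm_minus_commute)
    ultimately show ?thesis by (simp add: B_def)
  qed
  have "(\<lambda>n. \<integral>x. (cmod (w n x))\<^sup>2 \<partial>\<mu>) \<longlonglongrightarrow> (\<integral>x. (cmod (\<phi> x - s x))\<^sup>2 \<partial>\<mu>)"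
  proof (rule integral_dominated_convergence[where w="\<lambda>_. B\<^sup>2"])
    show "(\<lambda>x. (cmod (\<phi> x - s x))\<^sup>2) \<in> borel_measurable \<mu>"
      by (intro measurable_continuous continuous_intros continuous_\<phi> cont)
    show "(\<lambda>x. (cmod (w n x))\<^sup>2) \<in> borel_measurable \<mu>" for n
      by (intro measurable_continuous continuous_intros continuous_w)
    show "AE x in \<mu>. (\<lambda>n. (cmod (w n x))\<^sup>2) \<longlonglongrightarrow> (cmod (\<phi> x - s x))\<^sup>2"
      by (intro always_eventually allI tendsto_intros lim)
    show "AE x in \<mu>. norm ((cmod (w n x))\<^sup>2) \<le> B\<^sup>2" for n
      using w_le by (intro always_eventually allI) (simp add: power_mono)
  qed simp
  moreover have "(\<lambda>n. \<integral>x. (cmod (w n x))\<^sup>2 \<partial>\<mu>) \<longlonglongrightarrow> 0"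
    unfolding a_double[symmetric]
    using LIMSEQ_subseq_LIMSEQ[OF summable_LIMSEQ_zero[OF summable_a], of "\<lambda>n. 2 * n"]
    by (simp add: strict_mono_def o_def)
  ultimately have "(\<integral>x. (cmod (\<phi> x - s x))\<^sup>2 \<partial>\<mu>) = 0" by (rule LIMSEQ_unique)
  then have "\<phi> x - s x = 0"
    by (intro continuous_eq_0[where F="\<lambda>x. \<phi> x - s x"] continuous_intros continuous_\<phi> cont)
  then show ?thesis by (simp add: s_def)
qed

section \<open>Partial sums of the square root and their limit\<close>

definition partial_root :: "nat set \<Rightarrow> 'a \<Rightarrow> complex"
  where "partial_root S = (\<lambda>x. \<Sum>j\<in>S. of_real (inv_sqrt_coeff j) * w j x)"

lemma continuous_partial_root: "continuous_on UNIV (partial_root S)"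
  unfolding partial_root_def by (intro continuous_intros continuous_w)

lemma partial_root_inv: "partial_root S (ginv x) = cnj (partial_root S x)"
  by (simp add: partial_root_def w_inv)

lemma partial_root_square: "(partial_root S \<circledast> partial_root S) x =
    (\<Sum>i\<in>S. \<Sum>j\<in>S. of_real (inv_sqrt_coeff i * inv_sqrt_coeff j) * v (i + j) x)"
proof -
  have "(partial_root S \<circledast> partial_root S) x =
      (\<Sum>i\<in>S. of_real (inv_sqrt_coeff i) * (w i \<circledast> partial_root S) x)"
    unfolding partial_root_def[of S]
    by (intro convol_sum_left continuous_w continuous_partial_root[unfolded partial_root_def])
  also have "\<dots> = (\<Sum>i\<in>S. of_real (inv_sqrt_coeff i) *
      (\<Sum>j\<in>S. of_real (inv_sqrt_coeff j) * (w i \<circledast> w j) x))"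
    unfolding partial_root_def by (simp only: convol_sum_right continuous_w)
  finally show ?thesis by (simp add: w_convol_w sum_distrib_left mult.assoc)
qed

text \<open>A partial root is Hermitian, so its squared norm is its convolution square at the unit.
  The free set \<open>N\<close> allows an initial segment for boundedness and a far block for the
  Cauchy property.\<close>

lemma partial_root_norm:
  assumes "finite S" "finite N" "\<And>i j. i \<in> S \<Longrightarrow> j \<in> S \<Longrightarrow> i + j \<in> N"
  shows "(\<integral>x. (cmod (partial_root S x))\<^sup>2 \<partial>\<mu>) \<le> (\<Sum>m\<in>N. a m)"
proof -
  have "(\<integral>x. (cmod (partial_root S x))\<^sup>2 \<partial>\<mu>) = Re ((partial_root S \<circledast> partial_root S) e)"
    by (simp add: hermitian_square_unit partial_root_inv)
  also have "\<dots> = (\<Sum>(i, j)\<in>S \<times> S. inv_sqrt_coeff i * inv_sqrt_coeff j * a (i + j))"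
    by (simp add: partial_root_square a_def sum.cartesian_product case_prod_unfold flip: of_real_mult)
  also have "\<dots> \<le> (\<Sum>m\<in>N. a m)"
    using assms by (intro inv_sqrt_coeff_pairs_le a_nonneg) auto
  finally show ?thesis .
qed

lemma partial_root_Cauchy:
  assumes "\<epsilon> > 0"
  shows "\<exists>N. \<forall>i\<ge>N. \<forall>j\<ge>N. (\<integral>x. (cmod (partial_root {..<i} x - partial_root {..<j} x))\<^sup>2 \<partial>\<mu>) < \<epsilon>"
proof -
  obtain N where N: "\<forall>m\<ge>N. \<forall>n. norm (sum a {m..<n}) < \<epsilon>"
    using summable_a assms unfolding summable_Cauchy by blast
  have le: "(\<integral>x. (cmod (partial_root {..<i} x - partial_root {..<j} x))\<^sup>2 \<partial>\<mu>) < \<epsilon>" if "N \<le> j" "j \<le> i" for i j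
  proof -
    \<comment> \<open>Differences of partial sums are again partial roots, which is why
      \<open>partial_root\<close> takes an index set.\<close>
    have "partial_root {..<i} x - partial_root {..<j} x = partial_root {j..<i} x" for x
      unfolding partial_root_def using sum_diff_nat_ivl[of 0 j i] that by (simp add: atLeast0LessThan)
    then have "(\<integral>x. (cmod (partial_root {..<i} x - partial_root {..<j} x))\<^sup>2 \<partial>\<mu>) \<le> (\<Sum>m\<in>{2 * j..<2 * i}. a m)"
      by (simp only:) (rule partial_root_norm, auto)
    also have "\<dots> < \<epsilon>" using N that by (auto simp: abs_less_iff)
    finally show ?thesis .
  qed
  show ?thesis
  proof (intro exI allI impI)
    fix i j assume "N \<le> i" "N \<le> j"
    then show "(\<integral>x. (cmod (partial_root {..<i} x - partial_root {..<j} x))\<^sup>2 \<partial>\<mu>) < \<epsilon>"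
      using le[of i j] le[of j i] by (cases "i \<le> j") (simp_all add: norm_minus_commute)
  qed
qed

text \<open>The value of the chosen representative at \<open>x\<close> is a fixed expression in the
  sequence of the \<open>w j x\<close>. The last two conclusions record this, so that invariance and
  reality need checking only for the \<open>w j\<close>.\<close>

lemma convolution_root:
  obtains f where "L2 \<mu> f" "\<phi> = f \<circledast> breve ginv f"
    "\<And>x y. (\<And>j. w j x = w j y) \<Longrightarrow> f x = f y"
    "\<And>x. (\<And>j. w j x \<in> \<real>) \<Longrightarrow> f x \<in> \<real>"
proof -
  define F where "F n = partial_root {..<n}" for n
  have F: "L2 \<mu> (F n)" for n
    unfolding F_def by (intro L2_continuous continuous_partial_root)
  obtain r where r:
    "L2 \<mu> (\<lambda>x. if Cauchy (\<lambda>i. F (r i) x) then lim (\<lambda>i. F (r i) x) else 0)"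
    "(\<lambda>n. \<integral>x. (cmod ((if Cauchy (\<lambda>i. F (r i) x) then lim (\<lambda>i. F (r i) x) else 0) - F n x))\<^sup>2 \<partial>\<mu>) \<longlonglongrightarrow> 0"
    using L2_Cauchy_pointwise_limit[of F, OF F partial_root_Cauchy[folded F_def]] by blast
  define f where "f = (\<lambda>x. if Cauchy (\<lambda>i. F (r i) x) then lim (\<lambda>i. F (r i) x) else 0)"
  show thesis
  proof (rule that[of f])
    show "L2 \<mu> f" unfolding f_def by (rule r(1))
  next
    have "(f \<circledast> breve ginv f) x = \<phi> x" for x
    proof (rule LIMSEQ_unique)
      have "(\<integral>h. (cmod (F n h))\<^sup>2 \<partial>\<mu>) \<le> suminf a" for n
      proof -
        have "(\<integral>h. (cmod (F n h))\<^sup>2 \<partial>\<mu>) \<le> (\<Sum>m\<in>{..<2 * n}. a m)"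
          unfolding F_def by (rule partial_root_norm) auto
        also have "\<dots> \<le> suminf a" by (intro sum_le_suminf summable_a a_nonneg ballI) simp
        finally show ?thesis .
      qed
      then show "(\<lambda>n. (F n \<circledast> breve ginv (F n)) x) \<longlonglongrightarrow> (f \<circledast> breve ginv f) x"
        using r by (intro convol_breve_tendsto F) (simp_all add: f_def)
      \<comment> \<open>Partial roots are fixed by the involution, so the convolution with the
        adjoint is the convolution square, a Cauchy product in the \<open>v m\<close>.\<close>
      have "breve ginv (F n) = F n" for n
        by (simp add: breve_def F_def partial_root_inv)
      then have "(F n \<circledast> breve ginv (F n)) x =
          (\<Sum>i<n. \<Sum>j<n. of_real (inv_sqrt_coeff i * inv_sqrt_coeff j) * v (i + j) x)" for n
        by (simp only: F_def partial_root_square)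
      then show "(\<lambda>n. (F n \<circledast> breve ginv (F n)) x) \<longlonglongrightarrow> \<phi> x"
        using inv_sqrt_coeff_Cauchy_product[OF summable_v, of x] by (simp only: suminf_v)
    qed
    then show "\<phi> = f \<circledast> breve ginv f" by auto
  next
    show "f x = f y" if "\<And>j. w j x = w j y" for x y
      by (simp add: f_def F_def partial_root_def that)
  next
    show "f x \<in> \<real>" if "\<And>j. w j x \<in> \<real>" for x
    proof (cases "Cauchy (\<lambda>i. F (r i) x)")
      case True
      then have lim: "(\<lambda>i. F (r i) x) \<longlonglongrightarrow> f x"
        by (simp add: f_def Cauchy_convergent_iff convergent_LIMSEQ_iff)
      have "F n x \<in> \<real>" for n
        unfolding F_def partial_root_def by (intro sum_in_Reals Reals_mult Reals_of_real that)
      then show ?thesis by (rule closed_sequentially[OF closed_complex_Reals _ lim])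
    qed (simp add: f_def)
  qed
qed

section \<open>Inheritance of invariance and reality\<close>

lemma w_right_invariant:
  assumes "\<And>x. \<phi> (x \<odot> k) = \<phi> x"
  shows "w j (x \<odot> k) = w j x"
proof (induction j arbitrary: x)
  case (Suc j)
  then show ?case by (simp add: conv_def flip: assoc)
qed (simp add: assms)

text \<open>Substituting \<open>k \<odot> h\<close> for \<open>h\<close> cancels \<open>k\<close>
  inside the second factor of the convolution and moves it into \<phi>, which absorbs it.\<close>

lemma w_left_invariant:
  assumes "\<And>x. \<phi> (k \<odot> x) = \<phi> x"
  shows "w j (k \<odot> x) = w j x"
proof (induction j arbitrary: x)
  case (Suc j)
  have "(\<phi> \<circledast> w j) (k \<odot> x) = (\<integral>h. \<phi> (k \<odot> h) * w j (ginv (k \<odot> h) \<odot> (k \<odot> x)) \<partial>\<mu>)"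
    unfolding conv_def
    by (intro integral_translate[symmetric] borel_measurable_continuous_onI continuous_intros
        continuous_comp[OF continuous_w] continuous_\<phi>)
  also have "\<dots> = (\<phi> \<circledast> w j) x" by (simp add: conv_def assms inv_mult assoc)
  finally show ?case by (simp add: Suc.IH)
qed (simp add: assms)

lemma w_real:
  assumes "\<And>x. \<phi> x \<in> \<real>"
  shows "w j x \<in> \<real>"
proof (induction j arbitrary: x)
  case (Suc j)
  have "cnj ((\<phi> \<circledast> w j) x) = (\<phi> \<circledast> w j) x"
    using assms Suc.IH by (simp add: conv_def Reals_cnj_iff flip: Bochner_Integration.integral_cnj)
  then show ?case using Suc.IH[of x] by (simp add: Reals_cnj_iff)
qed (simp add: assms)

end

theorem theorem3p4:
  fixes gmul :: "'g::{t2_space,second_countable_topology} \<Rightarrow> 'g \<Rightarrow> 'g"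
    and ginv :: "'g \<Rightarrow> 'g" and e :: 'g
    and \<mu> :: "'g measure" and K :: "'g set" and \<phi> :: "'g \<Rightarrow> complex"
  assumes "compact_group gmul ginv e"
    and "haar_prob gmul \<mu>"
    and "closed_subgroup gmul ginv e K"
    and "continuous_on UNIV \<phi>"
    and "positive_definite gmul ginv \<phi>"
    and "bi_invariant gmul K \<phi>"
  shows "\<exists>f. L2 \<mu> f \<and> bi_invariant gmul K f \<and>
             \<phi> = conv \<mu> gmul ginv f (breve ginv f) \<and>
             ((\<forall>x. \<phi> x \<in> \<real>) \<longrightarrow> (\<forall>x. f x \<in> \<real>))"
proof -
  interpret G: compact_haar_group gmul ginv e \<mu>
    using assms(1,2) by unfold_locales
  \<comment> \<open>The summand 1 keeps the scaling constant positive even if \<phi> vanishes at the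
    unit.\<close>
  define c where "c = Re (\<phi> e) + 1"
  have c: "c > 0" using G.pd_unit(2)[OF assms(5)] by (simp add: c_def)
  interpret normalized_pd_function gmul ginv e \<mu> "\<lambda>x. \<phi> x / of_real c"
  proof
    show "continuous_on UNIV (\<lambda>x. \<phi> x / of_real c)"
      using c assms(4) by (intro continuous_intros) simp_all
    show "positive_definite gmul ginv (\<lambda>x. \<phi> x / of_real c)"
      using assms(5) c
      by (simp add: positive_definite_def Let_def sum_divide_distrib[symmetric] Re_divide_of_real Im_divide_of_real)
    show "Re (\<phi> e / of_real c) \<le> 1" using c by (simp add: c_def Re_divide_of_real)
  qed
  obtain f where f: "L2 \<mu> f" "(\<lambda>x. \<phi> x / of_real c) = conv \<mu> gmul ginv f (breve ginv f)"
    "\<And>x y. (\<And>j. w j x = w j y) \<Longrightarrow> f x = f y" "\<And>x. (\<And>j. w j x \<in> \<real>) \<Longrightarrow> f x \<in> \<real>"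
    using convolution_root by blast
  \<comment> \<open>Scaling \<open>f\<close> by \<open>s\<close> multiplies the convolution with its
    adjoint by \<open>s * cnj s\<close>, which undoes the division by \<open>c\<close>; a real
    \<open>s\<close> preserves reality.\<close>
  define s where "s = complex_of_real (sqrt c)"
  have s: "s * cnj s = of_real c" using c by (simp add: s_def flip: of_real_mult)
  \<comment> \<open>Taking the unit on one side splits bi-invariance into separate left and right
    invariance.\<close>
  have e: "e \<in> K" using assms(3) by (simp add: closed_subgroup_def)
  have left: "\<phi> (gmul k x) = \<phi> x" if "k \<in> K" for k x
    using assms(6) that e unfolding bi_invariant_def by (metis G.unit(2))
  have right: "\<phi> (gmul x k) = \<phi> x" if "k \<in> K" for k x
    using assms(6) that e unfolding bi_invariant_def by (metis G.unit(1))
  have bi_invariant: "f (gmul (gmul k1 x) k2) = f x" if "k1 \<in> K" "k2 \<in> K" for x k1 k2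
    using that by (intro f(3)) (simp add: w_right_invariant w_left_invariant left right)
  have "conv \<mu> gmul ginv (\<lambda>x. s * f x) (breve ginv (\<lambda>x. s * f x)) x = \<phi> x" for x
  proof -
    have "conv \<mu> gmul ginv (\<lambda>x. s * f x) (breve ginv (\<lambda>x. s * f x)) x =
        (\<integral>h. (s * cnj s) * (f h * breve ginv f (gmul (ginv h) x)) \<partial>\<mu>)"
      unfolding conv_def breve_def
      by (rule Bochner_Integration.integral_cong) (simp_all add: mult_ac)
    also have "\<dots> = of_real c * conv \<mu> gmul ginv f (breve ginv f) x"
      by (simp add: s conv_def)
    finally show ?thesis using c by (simp flip: f(2))
  qed
  moreover have "L2 \<mu> (\<lambda>x. s * f x)"
    using f(1) by (auto simp: L2_def norm_mult power_mult_distrib)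
  moreover have "s * f x \<in> \<real>" if "\<forall>x. \<phi> x \<in> \<real>" for x
    using that by (intro Reals_mult f(4) w_real) (auto simp: s_def)
  ultimately show ?thesis
    using bi_invariant by (intro exI[of _ "\<lambda>x. s * f x"]) (auto simp: bi_invariant_def)
qed

end
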